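(* The map $$\Phi:\mathcal{H}(\mathbb{C}^2)\to\mathcal{H}(\Omega),\qquad F\mapsto\Phi(F):=\Phi_+\big(\pi_+(F)\big)+\Phi_-\big(\pi_-(F)\big)$$ is a continuous linear bijection. Its inverse map is given by $$\Phi^{-1}:\mathcal{H}(\Omega)\to\mathcal{H}(\mathbb{C}^2),\qquad f\mapsto\Phi^{-1}(f)=\pi_+\big(f\circ\Psi_+^{-1}\big)+\pi_-\big(f\circ\Psi_-^{-1}\big).$$ In addition, the isomorphisms $\Phi:\mathcal{H}(\mathbb{C}^2)\to\mathcal{H}(\Omega)$ and $\Phi^{-1}:\mathcal{H}(\Omega)\to\mathcal{H}(\mathbb{C}^2)$ preserve the past and the future: $$\Phi\big(\mathcal{H}_-(\mathbb{C}^2)\big)=\mathcal{H}_-(\Omega),\qquad \Phi\big(\mathcal{H}_+(\mathbb{C}^2)\big)=\mathcal{H}_+(\Omega).$$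
   Context: $\hat{\mathbb{C}}=\mathbb{C}\cup\{\infty\}$ is the Riemann sphere, with conventions $z\cdot\infty=\infty\cdot z=\infty$ for $z\in\hat{\mathbb{C}}\setminus\{0\}$ and $0\cdot\infty=\infty\cdot 0=1$. $\Omega:=\{(z,w)\in\hat{\mathbb{C}}^2: z\cdot w\neq 1\}$, an open subset of $\hat{\mathbb{C}}^2$ and hence a complex manifold of dimension 2. For a complex manifold $U$, $\mathcal{H}(U)$ is the Fréchet space of holomorphic functions $U\to\mathbb{C}$ with the topology of locally uniform convergence. For $p,q\in\mathbb{N}_0$ let $f_{p,q}:\Omega\to\mathbb{C}$ be the holomorphic function given by $f_{p,q}(z,w)=\dfrac{z^pw^q}{(1-zw)^{\max\{p,q\}}}$ on $\Omega\cap\mathbb{C}^2$ and extended holomorphically to all of $\Omega$. $\mathcal{H}_+(\Omega)$ is the closed linear span in $\mathcal{H}(\Omega)$ of the $f_{p,q}$ with $p\ge q$, and $\mathcal{H}_-(\Omega)$ is the closed linear span in $\mathcal{H}(\Omega)$ of the $f_{p,q}$ with $p<q$. $\mathcal{H}_+(\mathbb{C}^2)$ (resp. $\mathcal{H}_-(\mathbb{C}^2)$) is the closed linear span in $\mathcal{H}(\mathbb{C}^2)$ of the monomials $z^pw^q$ with $p\ge q$ (resp. $p<q$). The projections $\pi_\pm:\mathcal{H}(\mathbb{C}^2)\to\mathcal{H}_\pm(\mathbb{C}^2)$ are $\pi_+\big(\sum_{p,q\ge0}a_{p,q}u^pv^q\big)=\sum_{p\ge q}a_{p,q}u^pv^q$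 and $\pi_-\big(\sum_{p,q\ge 0}a_{p,q}u^pv^q\big)=\sum_{p<q}a_{p,q}u^pv^q$. $\Omega_+:=\Omega\setminus\{(z,\infty):z\in\hat{\mathbb{C}}\}$ and $\Omega_-:=\Omega\setminus\{(\infty,w):w\in\hat{\mathbb{C}}\}$. The maps $\Psi_+:\Omega_+\to\mathbb{C}^2$, $\Psi_+(z,w)=\big(\frac{z}{1-zw},w\big)$, and $\Psi_-:\Omega_-\to\mathbb{C}^2$, $\Psi_-(z,w)=\big(z,\frac{w}{1-zw}\big)$ (extended holomorphically to the points with an infinite coordinate) are biholomorphic. In $f\circ\Psi_\pm^{-1}$, $f$ is restricted to $\Omega_\pm$. For $F\in\mathcal{H}_\pm(\mathbb{C}^2)$, $\Phi_\pm(F)\in\mathcal{H}_\pm(\Omega)$ denotes the (existing and unique) holomorphic extension to $\Omega$ of $F\circ\Psi_\pm\in\mathcal{H}(\Omega_\pm)$. *)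

theory Defs
  imports "HOL-Analysis.Analysis" "HOL-Library.Function_Algebras"
begin

text \<open>The point at infinity is \<^term>\<open>None\<close>; finite points are \<^term>\<open>Some z\<close>.\<close>

type_synonym csphere = "complex option"

definition csphere_top :: "csphere topology" where
  "csphere_top = Alexandroff_compactification euclidean"

text \<open>Note the convention \<open>0 \<cdot> \<infinity> = \<infinity> \<cdot> 0 = 1\<close>.\<close>

fun csphere_mult :: "csphere \<Rightarrow> csphere \<Rightarrow> csphere" where
  "csphere_mult (Some z) (Some w) = Some (z * w)"
| "csphere_mult None y = (if y = Some 0 then Some 1 else None)"
| "csphere_mult (Some z) None = (if z = 0 then Some 1 else None)"

definition Omega :: "(csphere \<times> csphere) set" where
  "Omega = {(z, w). csphere_mult z w \<noteq> Some 1}"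

definition Omega_plus :: "(csphere \<times> csphere) set" where
  "Omega_plus = Omega - {(z, None) | z. True}"

definition Omega_minus :: "(csphere \<times> csphere) set" where
  "Omega_minus = Omega - {(None, w) | w. True}"

definition holomorphic2_on :: "(complex \<times> complex \<Rightarrow> complex) \<Rightarrow> (complex \<times> complex) set \<Rightarrow> bool"
    (infixl "holomorphic2'_on" 50) where
  "F holomorphic2_on S \<longleftrightarrow>
     (\<forall>p\<in>S. \<exists>a b. (F has_derivative (\<lambda>(h, k). a * h + b * k)) (at p within S))"

text \<open>The inverses of the two standard charts \<open>z\<close> and \<open>1/z\<close> of the sphere.\<close>

definition chart_fin :: "complex \<Rightarrow> csphere" where
  "chart_fin t = Some t"

definition chart_inf :: "complex \<Rightarrow> csphere" where
  "chart_inf t = (if t = 0 then None else Some (1 / t))"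

text \<open>Holomorphy on an open subset of the product of two spheres, expressed in the four product
  charts.\<close>

definition holomorphic_csphere2_on ::
    "(csphere \<times> csphere \<Rightarrow> complex) \<Rightarrow> (csphere \<times> csphere) set \<Rightarrow> bool"
    (infixl "holomorphic'_csphere2'_on" 50) where
  "f holomorphic_csphere2_on U \<longleftrightarrow>
     (\<forall>\<phi>\<in>{chart_fin, chart_inf}. \<forall>\<psi>\<in>{chart_fin, chart_inf}.
        (f \<circ> map_prod \<phi> \<psi>) holomorphic2_on (map_prod \<phi> \<psi> -` U))"

definition Hol_C2 :: "(complex \<times> complex \<Rightarrow> complex) set" where
  "Hol_C2 = {F. F holomorphic2_on UNIV}"

text \<open>HOL functions are total, so a function on \<open>U\<close> is represented by the total function that
  vanishes outside \<open>U\<close>. This makes equality of functions on \<open>U\<close> plain equality and is compatible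
  with the pointwise vector space operations.\<close>

definition Hol :: "(csphere \<times> csphere) set \<Rightarrow> (csphere \<times> csphere \<Rightarrow> complex) set" where
  "Hol U = {f. f holomorphic_csphere2_on U \<and> (\<forall>x. x \<notin> U \<longrightarrow> f x = 0)}"

text \<open>Uniform convergence on the compact subsets of \<open>X\<close>. For locally compact \<open>X\<close>, which is the
  only case used, this is the topology of locally uniform convergence.\<close>

definition loc_unif_topology :: "'a topology \<Rightarrow> ('a \<Rightarrow> complex) set \<Rightarrow> ('a \<Rightarrow> complex) topology" where
  "loc_unif_topology X H = topology (\<lambda>V. V \<subseteq> H \<and>
     (\<forall>f\<in>V. \<exists>K e. compactin X K \<and> 0 < e \<and> {g\<in>H. \<forall>x\<in>K. cmod (g x - f x) < e} \<subseteq> V))"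

lemma openin_loc_unif_topology:
  "openin (loc_unif_topology X H) V \<longleftrightarrow> V \<subseteq> H \<and>
     (\<forall>f\<in>V. \<exists>K e. compactin X K \<and> 0 < e \<and> {g\<in>H. \<forall>x\<in>K. cmod (g x - f x) < e} \<subseteq> V)"
proof -
  let ?N = "\<lambda>f K e. {g\<in>H. \<forall>x\<in>K. cmod (g x - f x) < e}"
  let ?P = "\<lambda>V. V \<subseteq> H \<and> (\<forall>f\<in>V. \<exists>K e. compactin X K \<and> 0 < e \<and> ?N f K e \<subseteq> V)"
  have "istopology ?P"
    unfolding istopology_def
  proof (intro conjI allI impI)
    fix S T assume S: "?P S" and T: "?P T"
    show "S \<inter> T \<subseteq> H" using S by auto
    show "\<forall>f\<in>S \<inter> T. \<exists>K e. compactin X K \<and> 0 < e \<and> ?N f K e \<subseteq> S \<inter> T"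
    proof
      fix f assume f: "f \<in> S \<inter> T"
      obtain K1 e1 where 1: "compactin X K1" "0 < e1" "?N f K1 e1 \<subseteq> S"
        using S f by blast
      obtain K2 e2 where 2: "compactin X K2" "0 < e2" "?N f K2 e2 \<subseteq> T"
        using T f by blast
      have "compactin X (K1 \<union> K2)"
        using 1 2 by (simp add: compactin_Un)
      moreover have "0 < min e1 e2"
        using 1 2 by simp
      moreover have "?N f (K1 \<union> K2) (min e1 e2) \<subseteq> S \<inter> T"
        using 1(3) 2(3) by auto
      ultimately show "\<exists>K e. compactin X K \<and> 0 < e \<and> ?N f K e \<subseteq> S \<inter> T"
        by blast
    qed
  next
    fix \<K> assume *: "\<forall>K\<in>\<K>. ?P K"
    show "\<Union>\<K> \<subseteq> H"
      using * by blast
    show "\<forall>f\<in>\<Union>\<K>. \<exists>K e. compactin X K \<and> 0 < e \<and> ?N f K e \<subseteq> \<Union>\<K>"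
    proof
      fix f assume "f \<in> \<Union>\<K>"
      then obtain V where V: "V \<in> \<K>" "f \<in> V"
        by blast
      then obtain K e where "compactin X K" "0 < e" "?N f K e \<subseteq> V"
        using * by meson
      with V show "\<exists>K e. compactin X K \<and> 0 < e \<and> ?N f K e \<subseteq> \<Union>\<K>"
        by (meson Union_upper subset_trans)
    qed
  qed
  then show ?thesis
    by (simp add: loc_unif_topology_def)
qed

lemma topspace_loc_unif_topology [simp]: "topspace (loc_unif_topology X H) = H"
proof -
  have "openin (loc_unif_topology X H) H"
    unfolding openin_loc_unif_topology using compactin_empty zero_less_one by blast
  then show ?thesis
    by (meson openin_loc_unif_topology openin_subset openin_topspace subset_antisym)
qed

abbreviation Hol_C2_top :: "(complex \<times> complex \<Rightarrow> complex) topology" where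
  "Hol_C2_top \<equiv> loc_unif_topology euclidean Hol_C2"

abbreviation Hol_Omega_top :: "(csphere \<times> csphere \<Rightarrow> complex) topology" where
  "Hol_Omega_top \<equiv>
     loc_unif_topology (subtopology (prod_topology csphere_top csphere_top) Omega) (Hol Omega)"

definition cscale :: "complex \<Rightarrow> ('a \<Rightarrow> complex) \<Rightarrow> 'a \<Rightarrow> complex" where
  "cscale c f = (\<lambda>x. c * f x)"

interpretation cfun: vector_space cscale
  by unfold_locales (auto simp: cscale_def fun_eq_iff algebra_simps)

definition clinear_on :: "('a \<Rightarrow> complex) set \<Rightarrow> (('a \<Rightarrow> complex) \<Rightarrow> ('b \<Rightarrow> complex)) \<Rightarrow> bool" where
  "clinear_on H T \<longleftrightarrow>
     (\<forall>F\<in>H. \<forall>G\<in>H. T (F + G) = T F + T G) \<and> (\<forall>c. \<forall>F\<in>H. T (cscale c F) = cscale c (T F))"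

text \<open>The holomorphic extension to \<open>U\<close> of a function given on the finite points of \<open>U\<close>, and
  that of a function given on a subset \<open>D\<close> of \<open>U\<close>.\<close>

definition extend_fin ::
    "(csphere \<times> csphere) set \<Rightarrow> (complex \<Rightarrow> complex \<Rightarrow> complex) \<Rightarrow> csphere \<times> csphere \<Rightarrow> complex" where
  "extend_fin U h = (THE g. g \<in> Hol U \<and>
     (\<forall>z w. (Some z, Some w) \<in> U \<longrightarrow> g (Some z, Some w) = h z w))"

definition extend_from ::
    "(csphere \<times> csphere) set \<Rightarrow> (csphere \<times> csphere) set \<Rightarrow>
     (csphere \<times> csphere \<Rightarrow> complex) \<Rightarrow> csphere \<times> csphere \<Rightarrow> complex" where
  "extend_from D U h = (THE g. g \<in> Hol U \<and> (\<forall>x\<in>D. g x = h x))"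

definition f_fun :: "nat \<Rightarrow> nat \<Rightarrow> csphere \<times> csphere \<Rightarrow> complex" where
  "f_fun p q = extend_fin Omega (\<lambda>z w. z ^ p * w ^ q / (1 - z * w) ^ max p q)"

definition monom2 :: "nat \<Rightarrow> nat \<Rightarrow> complex \<times> complex \<Rightarrow> complex" where
  "monom2 p q = (\<lambda>(u, v). u ^ p * v ^ q)"

definition Hol_Omega_plus :: "(csphere \<times> csphere \<Rightarrow> complex) set" where
  "Hol_Omega_plus = Hol_Omega_top closure_of cfun.span {f_fun p q | p q. q \<le> p}"

definition Hol_Omega_minus :: "(csphere \<times> csphere \<Rightarrow> complex) set" where
  "Hol_Omega_minus = Hol_Omega_top closure_of cfun.span {f_fun p q | p q. p < q}"

definition Hol_C2_plus :: "(complex \<times> complex \<Rightarrow> complex) set" where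
  "Hol_C2_plus = Hol_C2_top closure_of cfun.span {monom2 p q | p q. q \<le> p}"

definition Hol_C2_minus :: "(complex \<times> complex \<Rightarrow> complex) set" where
  "Hol_C2_minus = Hol_C2_top closure_of cfun.span {monom2 p q | p q. p < q}"

text \<open>The coefficients of the (everywhere convergent) power series of \<open>F\<close>.\<close>

definition coeff2 :: "(complex \<times> complex \<Rightarrow> complex) \<Rightarrow> nat \<times> nat \<Rightarrow> complex" where
  "coeff2 F = (THE a. \<forall>x. ((\<lambda>(p, q). a (p, q) * monom2 p q x) has_sum F x) UNIV)"

definition pi_plus :: "(complex \<times> complex \<Rightarrow> complex) \<Rightarrow> complex \<times> complex \<Rightarrow> complex" where
  "pi_plus F = (\<lambda>x. \<Sum>\<^sub>\<infinity>(p, q)\<in>{(p, q). q \<le> p}. coeff2 F (p, q) * monom2 p q x)"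

definition pi_minus :: "(complex \<times> complex \<Rightarrow> complex) \<Rightarrow> complex \<times> complex \<Rightarrow> complex" where
  "pi_minus F = (\<lambda>x. \<Sum>\<^sub>\<infinity>(p, q)\<in>{(p, q). p < q}. coeff2 F (p, q) * monom2 p q x)"

definition Psi_plus :: "csphere \<times> csphere \<Rightarrow> complex \<times> complex" where
  "Psi_plus x = (extend_fin Omega_plus (\<lambda>z w. z / (1 - z * w)) x,
                 extend_fin Omega_plus (\<lambda>z w. w) x)"

definition Psi_minus :: "csphere \<times> csphere \<Rightarrow> complex \<times> complex" where
  "Psi_minus x = (extend_fin Omega_minus (\<lambda>z w. z) x,
                  extend_fin Omega_minus (\<lambda>z w. w / (1 - z * w)) x)"

definition Phi_plus :: "(complex \<times> complex \<Rightarrow> complex) \<Rightarrow> csphere \<times> csphere \<Rightarrow> complex" where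
  "Phi_plus F = extend_from Omega_plus Omega (F \<circ> Psi_plus)"

definition Phi_minus :: "(complex \<times> complex \<Rightarrow> complex) \<Rightarrow> csphere \<times> csphere \<Rightarrow> complex" where
  "Phi_minus F = extend_from Omega_minus Omega (F \<circ> Psi_minus)"

definition Phi :: "(complex \<times> complex \<Rightarrow> complex) \<Rightarrow> csphere \<times> csphere \<Rightarrow> complex" where
  "Phi F = Phi_plus (pi_plus F) + Phi_minus (pi_minus F)"

end

theory Submission
  imports Defs "HOL-Complex_Analysis.Complex_Analysis"
begin

text \<open>Call \<open>p - q\<close> the weight of \<open>u ^ p * v ^ q\<close>; it is the exponent of \<open>t\<close> after the
  substitution \<open>(u, v) \<mapsto> (t * u, v / t)\<close>. Collecting the monomials of weight \<open>\<ge> 0\<close> and those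
  of weight \<open>< 0\<close> writes every entire function of two variables in exactly one way as
  \<open>F (u, v) = G (u, u * v) + v * H (v, u * v)\<close> with \<open>G\<close>, \<open>H\<close> entire, and the two summands are
  \<open>pi_plus F\<close> and \<open>pi_minus F\<close> (\<open>weight_join_factors\<close>, \<open>factors_weight_join\<close>). Existence comes
  from the double Taylor series. Uniqueness is a Liouville argument in \<open>t\<close>: the future part is
  entire in \<open>t\<close>, the past part is a function of \<open>1 / t\<close> that vanishes at \<open>t = \<infinity>\<close>
  (\<open>weight_split_unique\<close>).

  The functions \<open>A = z / (1 - z * w)\<close>, \<open>B = w / (1 - z * w)\<close>, \<open>C = z * w / (1 - z * w)\<close> are
  holomorphic on all of \<open>Omega\<close>. Since \<open>Psi_plus = (A, w)\<close> and \<open>Psi_minus = (z, B)\<close> with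
  \<open>A * w = z * B = C\<close>, the function \<open>G (A, C) + B * H (B, C)\<close> is the holomorphic extension that
  defines \<open>Phi F\<close> (\<open>Phi_weight_join\<close>). It is visibly linear in \<open>F\<close>.

  Now let \<open>f\<close> be holomorphic on \<open>Omega\<close>, and split the pullbacks of \<open>f\<close> under the inverses of
  \<open>Psi_plus\<close> and \<open>Psi_minus\<close> as \<open>(G, H)\<close> and \<open>(G', H')\<close>. On finite points this reads
  \<open>G (A, C) + w * H (w, C) = f (z, w) = G' (z, C) + B * H' (B, C)\<close>. Here \<open>C\<close> is invariant under
  \<open>(z, w) \<mapsto> (t * z, w / t)\<close>, so the same uniqueness gives \<open>G (A, C) = G' (z, C)\<close>, hence
  \<open>f = G (A, C) + B * H' (B, C)\<close>, which is \<open>Phi\<close> of the function joined from \<open>G\<close> and \<open>H'\<close>. This is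
  surjectivity together with the formula for the inverse (\<open>Phi_inv_right_inverse\<close>). In the other
  direction, in the coordinates of \<open>Psi_plus\<close> one has \<open>B = v * (1 + u * v)\<close>, so the pullback of
  \<open>B * H (B, C)\<close> has only negative weights and is removed by \<open>pi_plus\<close>; symmetrically for
  \<open>Psi_minus\<close> (\<open>Phi_inv_Phi\<close>).

  Continuity of both maps follows from Cauchy's estimates: on a bidisc of radius at
  least \<open>1\<close>, \<open>G\<close> and \<open>H\<close> are bounded
  by four times the supremum of \<open>F\<close> on the bidisc of twice the radius (\<open>factor_bounds\<close>). Finally
  \<open>Phi\<close> sends the monomial \<open>u ^ p * v ^ q\<close> to \<open>f_fun p q\<close>, and a linear homeomorphism carries
  closed spans to closed spans.\<close>

section \<open>Complex differentiability in two variables\<close>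

definition holomorphic2_at :: "(complex \<times> complex \<Rightarrow> complex) \<Rightarrow> complex \<times> complex \<Rightarrow> bool" where
  "holomorphic2_at F p \<longleftrightarrow> (\<exists>a b. (F has_derivative (\<lambda>(h, k). a * h + b * k)) (at p))"

lemma holomorphic2_on_open:
  assumes "open S"
  shows "F holomorphic2_on S \<longleftrightarrow> (\<forall>p\<in>S. holomorphic2_at F p)"
  unfolding holomorphic2_on_def holomorphic2_at_def
  by (intro ball_cong refl) (metis at_within_open assms)

lemma Hol_C2_iff: "F \<in> Hol_C2 \<longleftrightarrow> (\<forall>p. holomorphic2_at F p)"
  by (simp add: Hol_C2_def holomorphic2_on_open)

lemma holomorphic2_atI:
  assumes "(F has_derivative D) (at p)" "\<And>h k. D (h, k) = a * h + b * k"
  shows "holomorphic2_at F p"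
proof -
  have "D = (\<lambda>(h, k). a * h + b * k)"
    using assms(2) by auto
  then show ?thesis
    using assms(1) unfolding holomorphic2_at_def by blast
qed

lemma holomorphic2_at_compose:
  assumes F: "holomorphic2_at F (g p, h p)" and g: "holomorphic2_at g p" and h: "holomorphic2_at h p"
  shows "holomorphic2_at (\<lambda>x. F (g x, h x)) p"
proof -
  obtain a b where F': "(F has_derivative (\<lambda>(h, k). a * h + b * k)) (at (g p, h p))"
    using F by (auto simp: holomorphic2_at_def)
  obtain a1 b1 where g': "(g has_derivative (\<lambda>(h, k). a1 * h + b1 * k)) (at p)"
    using g by (auto simp: holomorphic2_at_def)
  obtain a2 b2 where h': "(h has_derivative (\<lambda>(h, k). a2 * h + b2 * k)) (at p)"
    using h by (auto simp: holomorphic2_at_def)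
  have "((\<lambda>x. F (g x, h x)) has_derivative
          (\<lambda>x. (\<lambda>(h, k). a * h + b * k) ((\<lambda>(h, k). a1 * h + b1 * k) x, (\<lambda>(h, k). a2 * h + b2 * k) x))) (at p)"
    using has_derivative_compose[OF has_derivative_Pair[OF g' h'] F'] by simp
  then show ?thesis
    by (rule holomorphic2_atI[where a = "a * a1 + b * a2" and b = "a * b1 + b * b2"])
       (simp add: algebra_simps)
qed

lemma holomorphic2_at_const [simp]: "holomorphic2_at (\<lambda>x. c) p"
  by (rule holomorphic2_atI[OF has_derivative_const, where a = 0 and b = 0]) simp

lemma holomorphic2_at_fst [simp]: "holomorphic2_at fst p"
  by (rule holomorphic2_atI[OF has_derivative_fst[OF has_derivative_ident], where a = 1 and b = 0]) simp

lemma holomorphic2_at_snd [simp]: "holomorphic2_at snd p"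
  by (rule holomorphic2_atI[OF has_derivative_snd[OF has_derivative_ident], where a = 0 and b = 1]) simp

lemma holomorphic2_at_add:
  assumes "holomorphic2_at f p" "holomorphic2_at g p"
  shows "holomorphic2_at (\<lambda>x. f x + g x) p"
proof -
  have "holomorphic2_at (\<lambda>x. fst x + snd x) (f p, g p)"
    by (rule holomorphic2_atI[where a = 1 and b = 1]) (auto intro!: derivative_eq_intros)
  from holomorphic2_at_compose[OF this assms] show ?thesis
    by simp
qed

lemma holomorphic2_at_mult:
  assumes "holomorphic2_at f p" "holomorphic2_at g p"
  shows "holomorphic2_at (\<lambda>x. f x * g x) p"
proof -
  have "((\<lambda>x::complex\<times>complex. fst x * snd x) has_derivative
          (\<lambda>h. fst (f p, g p) * snd h + fst h * snd (f p, g p))) (at (f p, g p))"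
    by (intro has_derivative_mult has_derivative_fst has_derivative_snd has_derivative_ident)
  then have "holomorphic2_at (\<lambda>x. fst x * snd x) (f p, g p)"
    by (rule holomorphic2_atI[where a = "g p" and b = "f p"]) simp
  from holomorphic2_at_compose[OF this assms] show ?thesis
    by simp
qed

lemma holomorphic2_at_compose1:
  assumes f: "(f has_field_derivative d) (at (g p))" and g: "holomorphic2_at g p"
  shows "holomorphic2_at (\<lambda>x. f (g x)) p"
proof -
  obtain a b where g': "(g has_derivative (\<lambda>(h, k). a * h + b * k)) (at p)"
    using g by (auto simp: holomorphic2_at_def)
  have "((\<lambda>x. f (g x)) has_derivative (\<lambda>x. d * ((\<lambda>(h, k). a * h + b * k) x))) (at p)"
    using has_derivative_compose[OF g' f[unfolded has_field_derivative_def]] .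
  then show ?thesis
    by (rule holomorphic2_atI[where a = "d * a" and b = "d * b"]) (simp add: algebra_simps)
qed

lemma holomorphic2_at_diff:
  assumes "holomorphic2_at f p" "holomorphic2_at g p"
  shows "holomorphic2_at (\<lambda>x. f x - g x) p"
  using holomorphic2_at_add[OF assms(1) holomorphic2_at_mult[OF holomorphic2_at_const[of "-1"] assms(2)]]
  by simp

lemma holomorphic2_at_divide:
  assumes "holomorphic2_at f p" "holomorphic2_at g p" "g p \<noteq> 0"
  shows "holomorphic2_at (\<lambda>x. f x / g x) p"
proof -
  have "holomorphic2_at (\<lambda>x. inverse (g x)) p"
    by (rule holomorphic2_at_compose1[OF DERIV_inverse assms(2)]) (use assms in auto)
  from holomorphic2_at_mult[OF assms(1) this] show ?thesis
    by (simp add: divide_inverse)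
qed

lemma holomorphic2_at_power:
  assumes "holomorphic2_at f p"
  shows "holomorphic2_at (\<lambda>x. f x ^ n) p"
  by (induction n) (auto intro: holomorphic2_at_mult assms)

lemmas holomorphic2_at_intros =
  holomorphic2_at_const holomorphic2_at_fst holomorphic2_at_snd holomorphic2_at_add
  holomorphic2_at_mult holomorphic2_at_diff holomorphic2_at_divide holomorphic2_at_power

lemma holomorphic2_at_transform:
  assumes "holomorphic2_at f p" "open S" "p \<in> S" "\<And>x. x \<in> S \<Longrightarrow> f x = g x"
  shows "holomorphic2_at g p"
  using assms has_derivative_transform_within_open unfolding holomorphic2_at_def by blast

lemma holomorphic2_at_imp_isCont: "holomorphic2_at F p \<Longrightarrow> isCont F p"
  unfolding holomorphic2_at_def using has_derivative_continuous by blast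

lemma continuous_on_Hol_C2: "F \<in> Hol_C2 \<Longrightarrow> continuous_on S F"
  unfolding Hol_C2_iff using continuous_at_imp_continuous_on holomorphic2_at_imp_isCont by blast

lemma Hol_C2_compose:
  assumes "F \<in> Hol_C2" "g \<in> Hol_C2" "h \<in> Hol_C2"
  shows "(\<lambda>x. F (g x, h x)) \<in> Hol_C2"
  using assms holomorphic2_at_compose unfolding Hol_C2_iff by blast

lemma Hol_C2_add: "F \<in> Hol_C2 \<Longrightarrow> G \<in> Hol_C2 \<Longrightarrow> F + G \<in> Hol_C2"
  by (simp add: Hol_C2_iff plus_fun_def holomorphic2_at_add)

lemma Hol_C2_cscale: "F \<in> Hol_C2 \<Longrightarrow> cscale c F \<in> Hol_C2"
  by (simp add: Hol_C2_iff cscale_def holomorphic2_at_mult)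

lemma Hol_C2_curve_holomorphic:
  assumes F: "F \<in> Hol_C2" and g: "g holomorphic_on UNIV" and h: "h holomorphic_on UNIV"
  shows "(\<lambda>z. F (g z, h z)) holomorphic_on UNIV"
proof -
  have "\<exists>d. ((\<lambda>z. F (g z, h z)) has_field_derivative d) (at z)" for z
  proof -
    obtain a b where F': "(F has_derivative (\<lambda>(h, k). a * h + b * k)) (at (g z, h z))"
      using F unfolding Hol_C2_iff holomorphic2_at_def by blast
    obtain c where g': "(g has_derivative (\<lambda>x. c * x)) (at z)"
      using g by (auto simp: holomorphic_on_open has_field_derivative_def)
    obtain d where h': "(h has_derivative (\<lambda>x. d * x)) (at z)"
      using h by (auto simp: holomorphic_on_open has_field_derivative_def)
    have "((\<lambda>z. F (g z, h z)) has_derivative (\<lambda>x. a * (c * x) + b * (d * x))) (at z)"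
      using has_derivative_compose[OF has_derivative_Pair[OF g' h'] F'] by simp
    also have "(\<lambda>x. a * (c * x) + b * (d * x)) = (*) (a * c + b * d)"
      by (auto simp: algebra_simps)
    finally show ?thesis
      unfolding has_field_derivative_def by blast
  qed
  then show ?thesis
    by (simp add: holomorphic_on_open)
qed

section \<open>Double Taylor series of entire functions\<close>

text \<open>Cauchy's estimates produce bounds of this form on every bidisc; they are equivalent to
  absolute convergence of the double series everywhere, but shorter to transport through
  re-indexings.\<close>

definition entire_coeffs :: "(nat \<times> nat \<Rightarrow> complex) \<Rightarrow> bool" where
  "entire_coeffs a \<longleftrightarrow> (\<forall>R\<ge>1. \<exists>M. \<forall>p q. cmod (a (p, q)) * R ^ (p + q) \<le> M)"

definition power_series2 :: "(nat \<times> nat \<Rightarrow> complex) \<Rightarrow> complex \<times> complex \<Rightarrow> complex" where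
  "power_series2 a x = (\<Sum>\<^sub>\<infinity>(p, q). a (p, q) * monom2 p q x)"

lemma cmod_monom2_le:
  assumes "cmod x \<le> R" "cmod y \<le> R"
  shows "cmod (monom2 p q (x, y)) \<le> R ^ (p + q)"
proof -
  have R: "0 \<le> R"
    using assms(1) norm_ge_zero order_trans by blast
  have "cmod (monom2 p q (x, y)) = cmod x ^ p * cmod y ^ q"
    by (simp add: monom2_def norm_mult norm_power)
  also have "\<dots> \<le> R ^ p * R ^ q"
    using assms R by (intro mult_mono power_mono) auto
  finally show ?thesis
    by (simp add: power_add)
qed

lemma has_sum_geometric2:
  "((\<lambda>(p, q). c * ((1/2) ^ p * (1/2) ^ q)) has_sum (4 * c)) (UNIV :: (nat \<times> nat) set)" for c :: real
proof -
  have g: "((\<lambda>n. (1/2) ^ n) has_sum (2::real)) (UNIV :: nat set)"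
    using geometric_sums[of "1/2::real"] by (intro sums_nonneg_imp_has_sum) auto
  have "((\<lambda>(p, q). (1/2) ^ p * (1/2) ^ q) has_sum (4::real)) ((UNIV :: nat set) \<times> (UNIV :: nat set))"
  proof (rule has_sum_SigmaI)
    have 1: "((\<lambda>q. (1/2) ^ p * (1/2) ^ q) has_sum ((1/2) ^ p * (2::real))) (UNIV :: nat set)" for p :: nat
      by (intro has_sum_cmult_right g)
    then show "((\<lambda>q. case (p, q) of (p, q) \<Rightarrow> (1/2) ^ p * (1/2) ^ q) has_sum ((1/2) ^ p * (2::real))) (UNIV :: nat set)" for p :: nat
      by simp
    show 2: "((\<lambda>p. (1/2) ^ p * 2) has_sum (4::real)) (UNIV :: nat set)"
      using has_sum_cmult_left[OF g, of 2] by simp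
    show "(\<lambda>(p, q). (1/2::real) ^ p * (1/2) ^ q) summable_on ((UNIV :: nat set) \<times> (UNIV :: nat set))"
      by (rule summable_on_SigmaI[where g = "\<lambda>p. (1/2) ^ p * 2"])
         (use 1 has_sum_imp_summable[OF 2] in auto)
  qed
  from has_sum_cmult_right[OF this, of c] show ?thesis
    by (simp add: case_prod_unfold mult.commute)
qed

text \<open>Doubling the radius gains the factor \<open>2 ^ (p + q)\<close>, which turns a bound on the single
  terms into summability, with the constant \<open>4 = 2 * 2\<close> of the double geometric series.\<close>

lemma entire_coeffs_le_geometric:
  assumes "\<And>p q. cmod (a (p, q)) * (2 * R) ^ (p + q) \<le> M" and R: "1 \<le> R"
  shows "cmod (a (p, q)) * R ^ (p + q) \<le> M * ((1/2) ^ p * (1/2) ^ q)"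
proof -
  have "cmod (a (p, q)) * R ^ (p + q) * 2 ^ (p + q) \<le> M"
    using assms(1)[of p q] by (simp add: power_mult_distrib mult_ac)
  then have "cmod (a (p, q)) * R ^ (p + q) \<le> M / 2 ^ (p + q)"
    by (simp add: field_simps)
  then show ?thesis
    by (simp add: power_add power_divide)
qed

lemma entire_coeffs_abs_summable:
  assumes "entire_coeffs a" "1 \<le> R"
  shows "(\<lambda>(p, q). cmod (a (p, q)) * R ^ (p + q)) summable_on UNIV"
proof -
  have "1 \<le> 2 * R"
    using assms(2) by simp
  then obtain M where M: "\<And>p q. cmod (a (p, q)) * (2 * R) ^ (p + q) \<le> M"
    using assms(1) unfolding entire_coeffs_def by blast
  show ?thesis
  proof (rule summable_on_comparison_test)
    show "(\<lambda>(p, q). M * ((1/2) ^ p * (1/2) ^ q)) summable_on (UNIV :: (nat \<times> nat) set)"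
      using has_sum_geometric2 by (rule has_sum_imp_summable)
  qed (use entire_coeffs_le_geometric[of a R M] M assms(2) in auto)
qed

lemma power_series2_abs_summable:
  assumes "entire_coeffs a"
  shows "(\<lambda>pq. cmod (case pq of (p, q) \<Rightarrow> a (p, q) * monom2 p q x)) summable_on A"
proof -
  obtain u v where x: "x = (u, v)" by (cases x)
  define R where "R = max 1 (max (cmod u) (cmod v))"
  have R: "1 \<le> R" "cmod u \<le> R" "cmod v \<le> R"
    by (auto simp: R_def)
  have "(\<lambda>pq. cmod (case pq of (p, q) \<Rightarrow> a (p, q) * monom2 p q x)) summable_on UNIV"
  proof (rule Infinite_Sum.abs_summable_on_comparison_test'[OF entire_coeffs_abs_summable[OF assms R(1)]])
    fix pq :: "nat \<times> nat"
    show "cmod (case pq of (p, q) \<Rightarrow> a (p, q) * monom2 p q x) \<le> (case pq of (p, q) \<Rightarrow> cmod (a (p, q)) * R ^ (p + q))"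
      using cmod_monom2_le[OF R(2,3)] by (auto simp: x norm_mult intro!: mult_left_mono split: prod.split)
  qed
  then show ?thesis
    by (rule summable_on_subset_banach) simp
qed

lemma power_series2_summable:
  assumes "entire_coeffs a"
  shows "(\<lambda>(p, q). a (p, q) * monom2 p q x) summable_on A"
  by (rule abs_summable_summable[OF power_series2_abs_summable[OF assms]])

lemma power_series2_has_sum:
  assumes "entire_coeffs a"
  shows "((\<lambda>(p, q). a (p, q) * monom2 p q x) has_sum power_series2 a x) UNIV"
  unfolding power_series2_def by (rule has_sum_infsum[OF power_series2_summable[OF assms]])

lemma cmod_power_series2_le:
  assumes "\<And>p q. cmod (a (p, q)) * (2 * R) ^ (p + q) \<le> M" "entire_coeffs a" "1 \<le> R"
    and "cmod x \<le> R" "cmod y \<le> R"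
  shows "cmod (power_series2 a (x, y)) \<le> 4 * M"
proof (rule norm_infsum_le[OF power_series2_has_sum[OF assms(2)] has_sum_geometric2])
  fix pq :: "nat \<times> nat"
  obtain p q where pq: "pq = (p, q)" by (cases pq)
  have "cmod (a (p, q)) * cmod (monom2 p q (x, y)) \<le> cmod (a (p, q)) * R ^ (p + q)"
    by (intro mult_left_mono cmod_monom2_le assms) auto
  also have "\<dots> \<le> M * ((1/2) ^ p * (1/2) ^ q)"
    by (rule entire_coeffs_le_geometric) (use assms in auto)
  finally show "cmod (case pq of (p, q) \<Rightarrow> a (p, q) * monom2 p q (x, y)) \<le> (case pq of (p, q) \<Rightarrow> M * ((1/2) ^ p * (1/2) ^ q))"
    by (simp add: pq norm_mult)
qed

text \<open>A nonzero coefficient of positive degree would make the zeros of the sum isolated.\<close>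

lemma powser_coeffs_zero:
  fixes c :: "nat \<Rightarrow> complex"
  assumes "\<And>z. (\<lambda>n. c n * z ^ n) sums 0"
  shows "c n = 0"
proof (cases "n = 0")
  case True
  have "(\<lambda>n. c n * 0 ^ n) sums c 0"
    by (rule powser_sums_zero)
  then show ?thesis
    using sums_unique2[OF assms[of 0]] True by simp
next
  case False
  show ?thesis
  proof (rule ccontr)
    assume "c n \<noteq> 0"
    then obtain s :: real where "0 < s" "\<And>z::complex. z \<in> cball 0 s - {0} \<Longrightarrow> False"
      using powser_0_nonzero[of 1 0 c "\<lambda>_. 0" n] assms False by (metis diff_zero neq0_conv zero_less_one)
    moreover from this have "complex_of_real s \<in> cball 0 s - {0}"
      by auto
    ultimately show False
      by blast
  qed
qed

text \<open>Summing over \<open>q\<close> first leaves, for fixed \<open>v\<close>, a power series in \<open>u\<close> that vanishes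
  identically; so the uniqueness in one variable applies twice.\<close>

lemma power_series2_zero_imp_coeffs_zero:
  assumes "\<And>x. ((\<lambda>(p, q). a (p, q) * monom2 p q x) has_sum 0) UNIV"
  shows "a (p, q) = 0"
proof -
  define g where "g v p = (\<Sum>\<^sub>\<infinity>q. a (p, q) * v ^ q)" for v p
  have s: "(\<lambda>(p, q). a (p, q) * monom2 p q x) summable_on (UNIV \<times> UNIV)" for x
    using has_sum_imp_summable[OF assms] by simp
  have g1: "((\<lambda>q. a (p, q) * v ^ q) has_sum g v p) UNIV" for v p
  proof -
    have "(\<lambda>q. a (p, q) * monom2 p q (1, v)) summable_on UNIV"
      by (rule summable_on_SigmaD1[OF s]) simp
    then show ?thesis
      unfolding g_def by (simp add: monom2_def)
  qed
  have "((\<lambda>p. g v p * u ^ p) has_sum 0) UNIV" for u v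
  proof (rule has_sum_SigmaD)
    show "((\<lambda>(p, q). a (p, q) * monom2 p q (u, v)) has_sum 0) (UNIV \<times> UNIV)"
      using assms by simp
    show "((\<lambda>q. case (p, q) of (p, q) \<Rightarrow> a (p, q) * monom2 p q (u, v)) has_sum g v p * u ^ p) UNIV" for p
      using has_sum_cmult_left[OF g1[of p v], of "u ^ p"] by (simp add: monom2_def mult_ac)
  qed
  then have "g v p = 0" for v p
    using powser_coeffs_zero[of "g v" p] has_sum_imp_sums by blast
  then show ?thesis
    using powser_coeffs_zero[of "\<lambda>q. a (p, q)" q] has_sum_imp_sums[OF g1] by simp
qed

lemma coeff2_eqI:
  assumes "\<And>x. ((\<lambda>(p, q). a (p, q) * monom2 p q x) has_sum F x) UNIV"
  shows "coeff2 F = a"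
  unfolding coeff2_def
proof (rule the_equality)
  show "\<forall>x. ((\<lambda>(p, q). a (p, q) * monom2 p q x) has_sum F x) UNIV"
    using assms by simp
  fix b assume b: "\<forall>x. ((\<lambda>(p, q). b (p, q) * monom2 p q x) has_sum F x) UNIV"
  have "((\<lambda>(p, q). (b (p, q) - a (p, q)) * monom2 p q x) has_sum 0) UNIV" for x
    using has_sum_add[OF b[rule_format, of x] has_sum_cmult_right[OF assms[of x], of "-1"]] by (simp add: case_prod_unfold algebra_simps)
  then have "b (p, q) - a (p, q) = 0" for p q
    using power_series2_zero_imp_coeffs_zero[of "\<lambda>x. b x - a x" p q] by simp
  then show "b = a"
    by (simp add: fun_eq_iff)
qed

lemma monom2_has_derivative:
  "(monom2 p q has_derivative
     (\<lambda>(h, k). (of_nat p * u ^ (p - 1) * v ^ q) * h + (of_nat q * u ^ p * v ^ (q - 1)) * k)) (at (u, v))"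
proof -
  have "((\<lambda>x::complex\<times>complex. fst x ^ p * snd x ^ q) has_derivative
          (\<lambda>h. fst (u, v) ^ p * (of_nat q * snd h * snd (u, v) ^ (q - 1))
             + of_nat p * fst h * fst (u, v) ^ (p - 1) * snd (u, v) ^ q)) (at (u, v))"
    by (intro has_derivative_mult has_derivative_power has_derivative_fst has_derivative_snd has_derivative_ident)
  then show ?thesis
    by (simp add: monom2_def case_prod_unfold algebra_simps)
qed

text \<open>The factor \<open>p\<close> from differentiation is at most \<open>2 ^ p\<close>, so that it can be absorbed by
  doubling the radius.\<close>

lemma cmod_monom2_deriv_le:
  assumes "cmod u \<le> R" "cmod v \<le> R" "1 \<le> R"
  shows "cmod (of_nat p * u ^ (p - 1) * v ^ q) \<le> (2 * R) ^ (p + q)"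
    and "cmod (of_nat q * u ^ p * v ^ (q - 1)) \<le> (2 * R) ^ (p + q)"
proof -
  have *: "cmod (of_nat n * w ^ (n - 1) * w' ^ m) \<le> (2 * R) ^ (n + m)"
    if "cmod w \<le> R" "cmod w' \<le> R" for n m w w'
  proof -
    have "real n \<le> 2 ^ (n + m)"
      by (metis less_exp of_nat_le_iff of_nat_numeral of_nat_power le_add1 order.strict_implies_order order_trans)
    moreover have "cmod w ^ (n - 1) * cmod w' ^ m \<le> R ^ n * R ^ m"
    proof (intro mult_mono power_mono)
      show "cmod w ^ (n - 1) \<le> R ^ n"
        using power_mono[OF that(1) norm_ge_zero, of "n - 1"] power_increasing[of "n - 1" n R] assms(3)
        by simp
    qed (use that assms(3) in auto)
    ultimately have "real n * (cmod w ^ (n - 1) * cmod w' ^ m) \<le> 2 ^ (n + m) * (R ^ n * R ^ m)"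
      by (rule mult_mono) (use assms(3) in auto)
    then show ?thesis
      by (simp add: norm_mult norm_power power_mult_distrib power_add mult_ac)
  qed
  show "cmod (of_nat p * u ^ (p - 1) * v ^ q) \<le> (2 * R) ^ (p + q)"
    using *[of u v p q] assms by simp
  show "cmod (of_nat q * u ^ p * v ^ (q - 1)) \<le> (2 * R) ^ (p + q)"
    using *[of v u q p] assms by (simp add: mult_ac add.commute)
qed

text \<open>Termwise differentiation: on a ball the series of both partial derivatives are dominated
  by the summable \<open>m\<close>, hence converge uniformly. The double series is enumerated along
  \<open>prod_decode\<close> in order to use the theorem on derivatives of ordinary series.\<close>

lemma power_series2_in_Hol_C2:
  assumes a: "entire_coeffs a"
  shows "power_series2 a \<in> Hol_C2"
  unfolding Hol_C2_iff
proof
  fix x0 :: "complex \<times> complex"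
  define R where "R = norm x0 + 1"
  have R: "1 \<le> R"
    by (simp add: R_def)
  define S :: "(complex \<times> complex) set" where "S = ball 0 R"
  have x0: "x0 \<in> S"
    by (simp add: S_def R_def)
  have S: "cmod (fst x) \<le> R" "cmod (snd x) \<le> R" if "x \<in> S" for x
    using that norm_fst_le[of "fst x" "snd x"] norm_snd_le[of "snd x" "fst x"] by (auto simp: S_def)
  define P where "P n = fst (prod_decode n)" for n
  define Q where "Q n = snd (prod_decode n)" for n
  define c where "c n = a (prod_decode n)" for n
  define d1 where "d1 n x = c n * (of_nat (P n) * fst x ^ (P n - 1) * snd x ^ Q n)" for n x
  define d2 where "d2 n x = c n * (of_nat (Q n) * fst x ^ P n * snd x ^ (Q n - 1))" for n x
  define m where "m n = cmod (c n) * (2 * R) ^ (P n + Q n)" for n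
  have "1 \<le> 2 * R"
    using R by simp
  have "(m has_sum (\<Sum>\<^sub>\<infinity>(p, q). cmod (a (p, q)) * (2 * R) ^ (p + q))) UNIV"
    using has_sum_infsum[OF entire_coeffs_abs_summable[OF a \<open>1 \<le> 2 * R\<close>]]
    by (subst (asm) has_sum_reindex_bij_betw[OF bij_prod_decode, symmetric])
       (simp add: m_def[abs_def] c_def P_def Q_def case_prod_unfold)
  then have m: "summable m"
    using has_sum_imp_sums sums_summable by blast
  have d: "cmod (d1 n x) \<le> m n" "cmod (d2 n x) \<le> m n" if "x \<in> S" for n x
    using cmod_monom2_deriv_le(1)[OF S[OF that] R, where p = "P n" and q = "Q n"]
      cmod_monom2_deriv_le(2)[OF S[OF that] R, where p = "P n" and q = "Q n"]
    unfolding d1_def d2_def m_def norm_mult[of "c n"] by (auto intro!: mult_left_mono)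
  have u1: "uniform_limit S (\<lambda>n x. \<Sum>i<n. d1 i x) (\<lambda>x. \<Sum>i. d1 i x) sequentially"
    by (rule Weierstrass_m_test[OF d(1) m])
  have u2: "uniform_limit S (\<lambda>n x. \<Sum>i<n. d2 i x) (\<lambda>x. \<Sum>i. d2 i x) sequentially"
    by (rule Weierstrass_m_test[OF d(2) m])
  have sums: "(\<lambda>n. c n * monom2 (P n) (Q n) x) sums power_series2 a x" for x
  proof -
    have "((\<lambda>n. c n * monom2 (P n) (Q n) x) has_sum power_series2 a x) UNIV"
      using power_series2_has_sum[OF a, of x]
      by (subst (asm) has_sum_reindex_bij_betw[OF bij_prod_decode, symmetric])
         (simp add: c_def P_def Q_def case_prod_unfold)
    then show ?thesis
      by (rule has_sum_imp_sums)
  qed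
  have "\<exists>g. \<forall>x\<in>S. (\<lambda>n. c n * monom2 (P n) (Q n) x) sums g x \<and>
          (g has_derivative (\<lambda>(h, k). (\<Sum>i. d1 i x) * h + (\<Sum>i. d2 i x) * k)) (at x within S)"
  proof (rule has_derivative_series[where f' = "\<lambda>n x (h, k). d1 n x * h + d2 n x * k"])
    show "convex S"
      by (simp add: S_def)
    show "((\<lambda>x. c n * monom2 (P n) (Q n) x) has_derivative (\<lambda>(h, k). d1 n x * h + d2 n x * k)) (at x within S)"
      for n x
    proof -
      have "((\<lambda>x. c n * monom2 (P n) (Q n) x) has_derivative
              (\<lambda>y. c n * (case y of (h, k) \<Rightarrow> (of_nat (P n) * fst x ^ (P n - 1) * snd x ^ Q n) * h
                 + (of_nat (Q n) * fst x ^ P n * snd x ^ (Q n - 1)) * k))) (at x)"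
        using has_derivative_mult_right[OF monom2_has_derivative[of "P n" "Q n" "fst x" "snd x"], of "c n"]
        by simp
      then have "((\<lambda>x. c n * monom2 (P n) (Q n) x) has_derivative (\<lambda>(h, k). d1 n x * h + d2 n x * k)) (at x)"
        by (simp add: d1_def d2_def case_prod_unfold algebra_simps)
      then show ?thesis
        by (rule has_derivative_at_withinI)
    qed
    show "\<forall>\<^sub>F n in sequentially. \<forall>x\<in>S. \<forall>h. norm ((\<Sum>i<n. case h of (h, k) \<Rightarrow> d1 i x * h + d2 i x * k) -
            (case h of (h, k) \<Rightarrow> (\<Sum>i. d1 i x) * h + (\<Sum>i. d2 i x) * k)) \<le> e * norm h" if "e > 0" for e
    proof -
      have e: "e / 2 > 0" using that by simp
      show ?thesis
        using uniform_limitD[OF u1 e] uniform_limitD[OF u2 e]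
      proof eventually_elim
        case (elim n)
        show ?case
        proof (intro ballI allI)
          fix x and y :: "complex \<times> complex" assume x: "x \<in> S"
          obtain h k where y: "y = (h, k)" by (cases y)
          define E1 where "E1 = (\<Sum>i<n. d1 i x) - (\<Sum>i. d1 i x)"
          define E2 where "E2 = (\<Sum>i<n. d2 i x) - (\<Sum>i. d2 i x)"
          have E: "cmod E1 \<le> e / 2" "cmod E2 \<le> e / 2"
            using elim x by (auto simp: E1_def E2_def dist_norm intro: order.strict_implies_order)
          have hk: "cmod h \<le> norm y" "cmod k \<le> norm y"
            using norm_fst_le[of h k] norm_snd_le[of k h] by (auto simp: y)
          have "(\<Sum>i<n. case y of (h, k) \<Rightarrow> d1 i x * h + d2 i x * k) -
            (case y of (h, k) \<Rightarrow> (\<Sum>i. d1 i x) * h + (\<Sum>i. d2 i x) * k) = E1 * h + E2 * k"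
            by (simp add: y E1_def E2_def sum.distrib algebra_simps sum_distrib_left)
          also have "norm \<dots> \<le> cmod E1 * cmod h + cmod E2 * cmod k"
            by (metis norm_mult norm_triangle_ineq)
          also have "\<dots> \<le> e / 2 * norm y + e / 2 * norm y"
            using E hk that by (intro add_mono mult_mono) auto
          finally show "norm ((\<Sum>i<n. case y of (h, k) \<Rightarrow> d1 i x * h + d2 i x * k) -
            (case y of (h, k) \<Rightarrow> (\<Sum>i. d1 i x) * h + (\<Sum>i. d2 i x) * k)) \<le> e * norm y"
            by (simp add: field_simps)
        qed
      qed
    qed
    show "(\<lambda>n. c n * monom2 (P n) (Q n) x0) sums power_series2 a x0"
      by (rule sums)
  qed (rule x0)
  then obtain g where g: "\<And>x. x \<in> S \<Longrightarrow> (\<lambda>n. c n * monom2 (P n) (Q n) x) sums g x"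
    "\<And>x. x \<in> S \<Longrightarrow> (g has_derivative (\<lambda>(h, k). (\<Sum>i. d1 i x) * h + (\<Sum>i. d2 i x) * k)) (at x within S)"
    by blast
  have S_open: "open S"
    by (simp add: S_def)
  have "(g has_derivative (\<lambda>(h, k). (\<Sum>i. d1 i x0) * h + (\<Sum>i. d2 i x0) * k)) (at x0)"
    using g(2)[OF x0] by (simp add: at_within_open[OF x0 S_open])
  then have "holomorphic2_at g x0"
    unfolding holomorphic2_at_def by blast
  then show "holomorphic2_at (power_series2 a) x0"
    using holomorphic2_at_transform[OF _ S_open x0] sums_unique2[OF g(1) sums] by blast
qed

lemma Hol_C2_bounded_on_bidisc:
  assumes "K \<in> Hol_C2"
  obtains M where "\<And>u v. cmod u \<le> R \<Longrightarrow> cmod v \<le> R \<Longrightarrow> cmod (K (u, v)) \<le> M"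
proof -
  have "compact (K ` (cball 0 R \<times> cball 0 R))"
    using assms by (intro compact_continuous_image compact_Times continuous_on_Hol_C2) auto
  then obtain M where "\<forall>y\<in>K ` (cball 0 R \<times> cball 0 R). cmod y \<le> M"
    using compact_imp_bounded bounded_iff by blast
  then show ?thesis
    by (intro that[of M]) auto
qed

text \<open>The double series is obtained by expanding in \<open>u\<close> first; this is the coefficient of
  \<open>u ^ p\<close>, still a function of \<open>v\<close>.\<close>

definition slice_coeff :: "(complex \<times> complex \<Rightarrow> complex) \<Rightarrow> nat \<Rightarrow> complex \<Rightarrow> complex" where
  "slice_coeff K p v = (deriv ^^ p) (\<lambda>u. K (u, v)) 0 / fact p"

lemma slice_coeff_sums:
  assumes "K \<in> Hol_C2"
  shows "(\<lambda>p. slice_coeff K p v * u ^ p) sums K (u, v)"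
proof -
  have "(\<lambda>u. K (u, v)) holomorphic_on ball 0 (cmod u + 1)"
    using Hol_C2_curve_holomorphic[OF assms, of "\<lambda>u. u" "\<lambda>_. v"] holomorphic_on_subset by auto
  from holomorphic_power_series[OF this, of u] show ?thesis
    by (simp add: slice_coeff_def)
qed

lemma entire_Cauchy_inequality:
  assumes "f holomorphic_on UNIV" "0 < R" "\<And>z. cmod z \<le> R \<Longrightarrow> cmod (f z) \<le> M"
  shows "cmod ((deriv ^^ n) f 0 / fact n) \<le> M / R ^ n"
proof -
  have "cmod ((deriv ^^ n) f 0) \<le> fact n * M / R ^ n"
    using assms holomorphic_on_imp_continuous_on
    by (intro Cauchy_inequality) (auto intro: holomorphic_on_subset continuous_on_subset)
  then show ?thesis
    by (simp add: norm_divide field_simps)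
qed

lemma cmod_slice_coeff_le:
  assumes "K \<in> Hol_C2" "0 < R" "\<And>u v. cmod u \<le> R \<Longrightarrow> cmod v \<le> R \<Longrightarrow> cmod (K (u, v)) \<le> M"
    and "cmod v \<le> R"
  shows "cmod (slice_coeff K p v) \<le> M / R ^ p"
  unfolding slice_coeff_def
  using Hol_C2_curve_holomorphic[OF assms(1), of "\<lambda>u. u" "\<lambda>_. v"] assms
  by (intro entire_Cauchy_inequality) auto

text \<open>By induction on \<open>p\<close>: the coefficient is the limit of
  \<open>(K (t, v) - (\<Sum>j<p. slice_coeff K j v * t ^ j)) / t ^ p\<close> as \<open>t \<rightarrow> 0\<close>, locally uniformly in \<open>v\<close>
  by Cauchy's estimates in the first variable. Each of these quotients is holomorphic in \<open>v\<close>, and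
  no differentiation of a parameter integral is involved.\<close>

lemma slice_coeff_holomorphic:
  assumes K: "K \<in> Hol_C2"
  shows "slice_coeff K p holomorphic_on UNIV"
proof (induction p rule: less_induct)
  case (less p)
  define t :: "nat \<Rightarrow> complex" where "t n = 1 / of_nat (n + 2)" for n
  have t0: "t n \<noteq> 0" for n
    unfolding t_def add_2_eq_Suc' using of_nat_neq_0[of "Suc n"] by (simp del: of_nat_Suc)
  have tn: "cmod (t n) = 1 / real (n + 2)" for n
    unfolding t_def norm_divide norm_of_nat by simp
  have t_half: "cmod (t n) \<le> 1 / 2" for n
    unfolding tn by (simp add: field_simps)
  define f where "f n v = (K (t n, v) - (\<Sum>j<p. slice_coeff K j v * t n ^ j)) / t n ^ p" for n v
  show ?case
  proof (rule holomorphic_uniform_sequence)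
    show "f n holomorphic_on UNIV" for n
      unfolding f_def
      using Hol_C2_curve_holomorphic[OF K, of "\<lambda>_. t n" "\<lambda>v. v"] less t0
      by (intro holomorphic_intros) auto
    fix x :: complex
    define R where "R = cmod x + 1"
    have R: "1 \<le> R"
      by (simp add: R_def)
    obtain M where M: "\<And>u v. cmod u \<le> R \<Longrightarrow> cmod v \<le> R \<Longrightarrow> cmod (K (u, v)) \<le> M"
      using Hol_C2_bounded_on_bidisc[OF K] by blast
    have M0: "0 \<le> M"
      using M[of 0 0] R by (auto intro: order_trans[OF norm_ge_zero])
    have err: "cmod (f n v - slice_coeff K p v) \<le> 2 * M * cmod (t n)" if "v \<in> cball x 1" for n v
    proof -
      have v: "cmod v \<le> R"
        using that norm_triangle_ineq4[of x "x - v"] by (simp add: R_def dist_norm)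
      have c: "cmod (slice_coeff K j v) \<le> M" for j
      proof -
        have "cmod (slice_coeff K j v) \<le> M / R ^ j"
          using cmod_slice_coeff_le[OF K _ M v] R by simp
        also have "\<dots> \<le> M / 1"
          using R M0 by (intro divide_left_mono) auto
        finally show ?thesis by simp
      qed
      define D where "D = K (t n, v) - (\<Sum>j<Suc p. slice_coeff K j v * t n ^ j)"
      have "(\<lambda>i. slice_coeff K (i + Suc p) v * t n ^ (i + Suc p)) sums D"
        unfolding D_def by (rule sums_split_initial_segment[OF slice_coeff_sums[OF K]])
      moreover have "(\<lambda>i. M * cmod (t n) ^ Suc p * (1/2) ^ i) sums (M * cmod (t n) ^ Suc p * 2)"
        using sums_mult[OF geometric_sums[of "1/2::real"]] by simp
      moreover have "cmod (slice_coeff K (i + Suc p) v * t n ^ (i + Suc p)) \<le> M * cmod (t n) ^ Suc p * (1/2) ^ i" for i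
      proof -
        have "cmod (slice_coeff K (i + Suc p) v * t n ^ (i + Suc p)) =
                cmod (slice_coeff K (i + Suc p) v) * (cmod (t n) ^ Suc p * cmod (t n) ^ i)"
          by (simp add: norm_mult norm_power power_add mult_ac)
        also have "\<dots> \<le> M * (cmod (t n) ^ Suc p * (1/2) ^ i)"
          using c t_half M0 by (intro mult_mono power_mono) auto
        finally show ?thesis
          by (simp add: mult_ac)
      qed
      ultimately have D: "cmod D \<le> M * cmod (t n) ^ Suc p * 2"
        by (rule norm_sums_le)
      have "f n v - slice_coeff K p v = D / t n ^ p"
        using t0[of n] by (simp add: f_def D_def field_simps)
      then have "cmod (f n v - slice_coeff K p v) = cmod D / cmod (t n) ^ p"
        by (simp add: norm_divide norm_power)
      also have "\<dots> \<le> (M * cmod (t n) ^ Suc p * 2) / cmod (t n) ^ p"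
        by (intro divide_right_mono D) auto
      also have "\<dots> = 2 * M * cmod (t n)"
        using t0[of n] by (simp add: field_simps)
      finally show ?thesis .
    qed
    have lim: "(\<lambda>n. 2 * M * cmod (t n)) \<longlonglongrightarrow> 0"
    proof -
      have "(\<lambda>n. 1 / real (n + 2)) \<longlonglongrightarrow> 0"
        using LIMSEQ_ignore_initial_segment[OF lim_1_over_n[where 'a = real], of 2] by simp
      from tendsto_mult_right_zero[OF this, of "2 * M"] show ?thesis
        unfolding tn .
    qed
    have "uniform_limit (cball x 1) f (slice_coeff K p) sequentially"
    proof (rule uniform_limitI)
      fix e :: real assume "e > 0"
      from order_tendstoD(2)[OF lim this] show "\<forall>\<^sub>F n in sequentially. \<forall>v\<in>cball x 1. dist (f n v) (slice_coeff K p v) < e"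
      proof eventually_elim
        case (elim n)
        then show ?case
          unfolding dist_norm using err le_less_trans by blast
      qed
    qed
    then show "\<exists>d>0. cball x d \<subseteq> UNIV \<and> uniform_limit (cball x d) f (slice_coeff K p) sequentially"
      by (intro exI[of _ 1]) auto
  qed auto
qed

text \<open>Both expansions, first in \<open>u\<close> and then in \<open>v\<close>, come with Cauchy's estimates, which
  together give the decay that makes the iterated sum a double sum.\<close>

theorem entire_power_series_expansion:
  assumes K: "K \<in> Hol_C2"
  shows "entire_coeffs (coeff2 K)" and "power_series2 (coeff2 K) = K"
    and "0 < R \<Longrightarrow> (\<And>u v. cmod u \<le> R \<Longrightarrow> cmod v \<le> R \<Longrightarrow> cmod (K (u, v)) \<le> M) \<Longrightarrow>
           cmod (coeff2 K (p, q)) * R ^ (p + q) \<le> M"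
proof -
  define a where "a = (\<lambda>(p, q). (deriv ^^ q) (slice_coeff K p) 0 / fact q)"
  have bound: "cmod (a (p, q)) * R ^ (p + q) \<le> M"
    if "0 < R" "\<And>u v. cmod u \<le> R \<Longrightarrow> cmod v \<le> R \<Longrightarrow> cmod (K (u, v)) \<le> M" for R M p q
  proof -
    have "cmod (a (p, q)) \<le> M / R ^ p / R ^ q"
      unfolding a_def prod.case using cmod_slice_coeff_le[OF K that]
      by (intro entire_Cauchy_inequality slice_coeff_holomorphic[OF K] that(1))
    then show ?thesis
      using that(1) by (simp add: field_simps power_add)
  qed
  have ent: "entire_coeffs a"
    unfolding entire_coeffs_def
  proof (intro allI impI)
    fix R :: real assume R: "1 \<le> R"
    obtain M where "\<And>u v. cmod u \<le> R \<Longrightarrow> cmod v \<le> R \<Longrightarrow> cmod (K (u, v)) \<le> M"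
      using Hol_C2_bounded_on_bidisc[OF K] by blast
    then show "\<exists>M. \<forall>p q. cmod (a (p, q)) * R ^ (p + q) \<le> M"
      using bound[of R M] R by (intro exI[of _ M]) auto
  qed
  have ps: "power_series2 a x = K x" for x
  proof -
    obtain u v where x: "x = (u, v)" by (cases x)
    have ptw: "(\<lambda>(p, q). a (p, q) * monom2 p q (u, v)) summable_on (UNIV \<times> UNIV)" for u v
      using power_series2_summable[OF ent] by blast
    have inner: "((\<lambda>q. a (p, q) * monom2 p q (u, v)) has_sum slice_coeff K p v * u ^ p) UNIV" for p
    proof -
      have "(\<lambda>q. a (p, q) * monom2 p q (1, v)) summable_on UNIV"
        by (rule summable_on_SigmaD1[OF ptw]) simp
      then have s: "(\<lambda>q. a (p, q) * v ^ q) summable_on UNIV"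
        by (simp add: monom2_def)
      have "slice_coeff K p holomorphic_on ball 0 (cmod v + 1)"
        using slice_coeff_holomorphic[OF K] holomorphic_on_subset by blast
      from holomorphic_power_series[OF this, of v] have "(\<lambda>q. a (p, q) * v ^ q) sums slice_coeff K p v"
        by (simp add: a_def)
      then have "((\<lambda>q. a (p, q) * v ^ q) has_sum slice_coeff K p v) UNIV"
        using has_sum_infsum[OF s] has_sum_imp_sums sums_unique2 by metis
      from has_sum_cmult_left[OF this, of "u ^ p"] show ?thesis
        by (simp add: monom2_def mult_ac)
    qed
    have "((\<lambda>p. slice_coeff K p v * u ^ p) has_sum power_series2 a (u, v)) UNIV"
    proof (rule has_sum_SigmaD)
      show "((\<lambda>(p, q). a (p, q) * monom2 p q (u, v)) has_sum power_series2 a (u, v)) (UNIV \<times> UNIV)"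
        using power_series2_has_sum[OF ent] by simp
    qed (use inner in simp)
    then show ?thesis
      unfolding x by (metis has_sum_imp_sums sums_unique2 slice_coeff_sums[OF K])
  qed
  have "coeff2 K = a"
    by (rule coeff2_eqI) (use power_series2_has_sum[OF ent] ps in simp)
  then show "entire_coeffs (coeff2 K)" "power_series2 (coeff2 K) = K"
    "0 < R \<Longrightarrow> (\<And>u v. cmod u \<le> R \<Longrightarrow> cmod v \<le> R \<Longrightarrow> cmod (K (u, v)) \<le> M) \<Longrightarrow>
           cmod (coeff2 K (p, q)) * R ^ (p + q) \<le> M"
    using ent ps bound by auto
qed

section \<open>The splitting of entire functions by weight\<close>

text \<open>\<open>E\<close> is entire and tends to \<open>0\<close> at infinity because \<open>P\<close> is bounded near \<open>0\<close>; Liouville.\<close>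

lemma entire_eq_principal_part_imp_zero:
  assumes E: "E holomorphic_on UNIV" and P: "P holomorphic_on UNIV"
    and eq: "\<And>t. t \<noteq> 0 \<Longrightarrow> E t = P (inverse t) / t"
  shows "E t = 0"
proof (rule Liouville_weak_0[OF E])
  have "isCont P 0"
    using holomorphic_on_imp_continuous_on[OF P] continuous_on_eq_continuous_at[OF open_UNIV] by blast
  have "((P \<circ> inverse) \<longlongrightarrow> P 0) at_infinity"
    using \<open>isCont P 0\<close> by (intro tendsto_compose_at[OF tendsto_inverse_0]) (auto simp: isCont_def)
  then have "((\<lambda>t. (P \<circ> inverse) t * inverse t) \<longlongrightarrow> P 0 * 0) at_infinity"
    by (intro tendsto_mult tendsto_inverse_0)
  then have "((\<lambda>t. (P \<circ> inverse) t * inverse t) \<longlongrightarrow> 0) at_infinity"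
    by simp
  then show "(E \<longlongrightarrow> 0) at_infinity"
  proof (rule Lim_transform_eventually)
    have "\<forall>\<^sub>F t::complex in at_infinity. t \<noteq> 0"
      by (auto simp: eventually_at_infinity intro!: exI[of _ 1])
    then show "\<forall>\<^sub>F t in at_infinity. (P \<circ> inverse) t * inverse t = E t"
      by eventually_elim (simp add: eq divide_inverse)
  qed
qed

lemma Hol_C2_slice_holomorphic:
  assumes "F \<in> Hol_C2"
  shows "(\<lambda>t. F (t * x, c)) holomorphic_on UNIV"
  by (rule Hol_C2_curve_holomorphic[OF assms]) (intro holomorphic_intros)+

text \<open>On the monomials of \<open>G\<close> and \<open>H\<close>: \<open>u ^ k * (u * v) ^ q\<close> has \<open>u\<close>-degree at least its
  \<open>v\<close>-degree, while \<open>v * v ^ k * (u * v) ^ p\<close> has larger \<open>v\<close>-degree. So the two summands are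
  the future and the past part.\<close>
definition weight_join :: "(complex \<times> complex \<Rightarrow> complex) \<Rightarrow> (complex \<times> complex \<Rightarrow> complex) \<Rightarrow>
    complex \<times> complex \<Rightarrow> complex" where
  "weight_join G H = (\<lambda>(u, v). G (u, u * v) + v * H (v, u * v))"

text \<open>Comparing the two sides as functions of \<open>t\<close>: the difference of the \<open>G\<close>-terms is entire,
  that of the \<open>H\<close>-terms is a principal part, so both vanish. The arguments on the two sides may
  differ (\<open>x\<close>, \<open>y\<close> against \<open>x'\<close>, \<open>y'\<close>); this freedom is what allows two coordinate systems on
  \<open>Omega\<close> to be compared.\<close>

lemma weight_split_unique:
  assumes "G \<in> Hol_C2" "G' \<in> Hol_C2" "H \<in> Hol_C2" "H' \<in> Hol_C2"
    and eq: "\<And>t. t \<noteq> 0 \<Longrightarrow>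
      G (t * x, c) + y / t * H (y / t, c) = G' (t * x', c) + y' / t * H' (y' / t, c)"
  shows "G (x, c) = G' (x', c)" and "y * H (y, c) = y' * H' (y', c)"
proof -
  define E where "E t = G (t * x, c) - G' (t * x', c)" for t
  define P where "P s = y' * H' (s * y', c) - y * H (s * y, c)" for s
  have E: "E holomorphic_on UNIV"
    unfolding E_def by (intro holomorphic_on_diff Hol_C2_slice_holomorphic assms)
  have P: "P holomorphic_on UNIV"
    unfolding P_def by (intro holomorphic_on_diff holomorphic_on_mult holomorphic_on_const Hol_C2_slice_holomorphic assms)
  have "E t = P (inverse t) / t" if "t \<noteq> 0" for t
    using eq[OF that] unfolding E_def P_def
    by (simp add: diff_divide_distrib divide_inverse mult_ac) (simp add: algebra_simps)
  then have "E 1 = 0"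
    by (rule entire_eq_principal_part_imp_zero[OF E P])
  then show "G (x, c) = G' (x', c)"
    by (simp add: E_def)
  with eq[of 1] show "y * H (y, c) = y' * H' (y', c)"
    by simp
qed

text \<open>The two shears below re-index the coefficients of \<open>F\<close> in the half planes \<open>q \<le> p\<close> and
  \<open>p < q\<close> by all of \<open>\<nat> \<times> \<nat>\<close>, according to \<open>u ^ p * v ^ q = u ^ (p - q) * (u * v) ^ q\<close> and
  \<open>u ^ p * v ^ q = v * v ^ (q - p - 1) * (u * v) ^ p\<close>.\<close>

definition plus_coeffs :: "(nat \<times> nat \<Rightarrow> complex) \<Rightarrow> nat \<times> nat \<Rightarrow> complex" where
  "plus_coeffs a = (\<lambda>(k, q). a (q + k, q))"

definition minus_coeffs :: "(nat \<times> nat \<Rightarrow> complex) \<Rightarrow> nat \<times> nat \<Rightarrow> complex" where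
  "minus_coeffs a = (\<lambda>(k, p). a (p, p + Suc k))"

lemma coeff_bound_mono:
  assumes "cmod c * R ^ n \<le> M" "m \<le> n" "1 \<le> R"
  shows "cmod c * R ^ m \<le> M"
  using assms(1) mult_left_mono[OF power_increasing[OF assms(2,3)] norm_ge_zero[of c]] by linarith

lemma plus_coeffs_bound:
  assumes "\<And>p q. cmod (a (p, q)) * R ^ (p + q) \<le> M" "1 \<le> R"
  shows "cmod (plus_coeffs a (k, q)) * R ^ (k + q) \<le> M"
  using coeff_bound_mono[OF assms(1)[of "q + k" q], of "k + q"] assms(2) by (simp add: plus_coeffs_def)

lemma minus_coeffs_bound:
  assumes "\<And>p q. cmod (a (p, q)) * R ^ (p + q) \<le> M" "1 \<le> R"
  shows "cmod (minus_coeffs a (k, p)) * R ^ (k + p) \<le> M"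
  using coeff_bound_mono[OF assms(1)[of p "p + Suc k"], of "k + p"] assms(2) by (simp add: minus_coeffs_def)

lemma entire_plus_coeffs: "entire_coeffs a \<Longrightarrow> entire_coeffs (plus_coeffs a)"
  unfolding entire_coeffs_def using plus_coeffs_bound by metis

lemma entire_minus_coeffs: "entire_coeffs a \<Longrightarrow> entire_coeffs (minus_coeffs a)"
  unfolding entire_coeffs_def using minus_coeffs_bound by metis

definition plus_factor :: "(complex \<times> complex \<Rightarrow> complex) \<Rightarrow> complex \<times> complex \<Rightarrow> complex" where
  "plus_factor F = power_series2 (plus_coeffs (coeff2 F))"

definition minus_factor :: "(complex \<times> complex \<Rightarrow> complex) \<Rightarrow> complex \<times> complex \<Rightarrow> complex" where
  "minus_factor F = power_series2 (minus_coeffs (coeff2 F))"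

lemma plus_factor_in_Hol_C2: "F \<in> Hol_C2 \<Longrightarrow> plus_factor F \<in> Hol_C2"
  by (simp add: plus_factor_def power_series2_in_Hol_C2 entire_plus_coeffs entire_power_series_expansion)

lemma minus_factor_in_Hol_C2: "F \<in> Hol_C2 \<Longrightarrow> minus_factor F \<in> Hol_C2"
  by (simp add: minus_factor_def power_series2_in_Hol_C2 entire_minus_coeffs entire_power_series_expansion)

lemma pi_plus_eq: "pi_plus F (u, v) = plus_factor F (u, u * v)"
  unfolding pi_plus_def plus_factor_def power_series2_def
proof (rule infsum_reindex_bij_witness[where i = "\<lambda>(k, q). (q + k, q)" and j = "\<lambda>(p, q). (p - q, q)"])
  fix pq assume "pq \<in> {(p, q). q \<le> (p::nat)}"
  then obtain q k where pq: "pq = (q + k, q)"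
    by (auto simp: le_iff_add)
  show "(case case pq of (p, q) \<Rightarrow> (p - q, q) of
            (k, q) \<Rightarrow> plus_coeffs (coeff2 F) (k, q) * monom2 k q (u, u * v)) =
        (case pq of (p, q) \<Rightarrow> coeff2 F (p, q) * monom2 p q (u, v))"
    by (simp add: pq plus_coeffs_def monom2_def power_mult_distrib power_add)
qed auto

lemma pi_minus_eq: "pi_minus F (u, v) = v * minus_factor F (v, u * v)"
proof -
  have "pi_minus F (u, v) =
          (\<Sum>\<^sub>\<infinity>kp. v * (case kp of (k, p) \<Rightarrow> minus_coeffs (coeff2 F) (k, p) * monom2 k p (v, u * v)))"
    unfolding pi_minus_def
  proof (rule infsum_reindex_bij_witness[where i = "\<lambda>(k, p). (p, p + Suc k)" and j = "\<lambda>(p, q). (q - Suc p, p)"])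
    fix pq assume "pq \<in> {(p, q). p < (q::nat)}"
    then obtain p k where pq: "pq = (p, p + Suc k)"
      using less_iff_Suc_add by auto
    show "v * (case case pq of (p, q) \<Rightarrow> (q - Suc p, p) of
              (k, p) \<Rightarrow> minus_coeffs (coeff2 F) (k, p) * monom2 k p (v, u * v)) =
          (case pq of (p, q) \<Rightarrow> coeff2 F (p, q) * monom2 p q (u, v))"
      by (simp add: pq minus_coeffs_def monom2_def power_mult_distrib power_add)
  qed auto
  then show ?thesis
    by (simp add: infsum_cmult_right' minus_factor_def power_series2_def)
qed

lemma pi_plus_add_pi_minus:
  assumes "F \<in> Hol_C2"
  shows "pi_plus F + pi_minus F = F"
proof
  fix x :: "complex \<times> complex"
  let ?f = "\<lambda>(p, q). coeff2 F (p, q) * monom2 p q x"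
  note s = power_series2_summable[OF entire_power_series_expansion(1)[OF assms], of x]
  have "(pi_plus F + pi_minus F) x = infsum ?f {(p, q). q \<le> p} + infsum ?f {(p, q). p < q}"
    by (simp add: pi_plus_def pi_minus_def)
  also have "\<dots> = infsum ?f ({(p, q). q \<le> p} \<union> {(p, q). p < q})"
    by (rule infsum_Un_disjoint[symmetric]) (use s in auto)
  also have "{(p, q). q \<le> p} \<union> {(p, q). p < q} = (UNIV :: (nat \<times> nat) set)"
    by auto
  also have "infsum ?f UNIV = F x"
    using fun_cong[OF entire_power_series_expansion(2)[OF assms], of x] by (simp add: power_series2_def)
  finally show "(pi_plus F + pi_minus F) x = F x" .
qed

lemma weight_join_factors:
  assumes "F \<in> Hol_C2"
  shows "weight_join (plus_factor F) (minus_factor F) = F"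
proof
  fix x :: "complex \<times> complex"
  obtain u v where x: "x = (u, v)" by (cases x)
  show "weight_join (plus_factor F) (minus_factor F) x = F x"
    using fun_cong[OF pi_plus_add_pi_minus[OF assms], of x]
    by (simp add: x weight_join_def pi_plus_eq pi_minus_eq)
qed

lemma factor_bounds:
  assumes F: "F \<in> Hol_C2" and R: "1 \<le> R"
    and M: "\<And>u v. cmod u \<le> 2 * R \<Longrightarrow> cmod v \<le> 2 * R \<Longrightarrow> cmod (F (u, v)) \<le> M"
    and xy: "cmod x \<le> R" "cmod y \<le> R"
  shows "cmod (plus_factor F (x, y)) \<le> 4 * M" and "cmod (minus_factor F (x, y)) \<le> 4 * M"
proof -
  have R2: "1 \<le> 2 * R" "0 < 2 * R"
    using R by auto
  note b = entire_power_series_expansion(3)[OF F R2(2) M]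
  note e = entire_power_series_expansion(1)[OF F]
  show "cmod (plus_factor F (x, y)) \<le> 4 * M"
    unfolding plus_factor_def
    using plus_coeffs_bound[OF b R2(1)] entire_plus_coeffs[OF e] R xy by (rule cmod_power_series2_le)
  show "cmod (minus_factor F (x, y)) \<le> 4 * M"
    unfolding minus_factor_def
    using minus_coeffs_bound[OF b R2(1)] entire_minus_coeffs[OF e] R xy by (rule cmod_power_series2_le)
qed

lemma Hol_C2_const_fst_snd [simp]:
  "(\<lambda>x. c) \<in> Hol_C2" "fst \<in> Hol_C2" "snd \<in> Hol_C2"
  by (simp_all add: Hol_C2_iff del: split_paired_All)

lemma Hol_C2_mult: "F \<in> Hol_C2 \<Longrightarrow> G \<in> Hol_C2 \<Longrightarrow> (\<lambda>x. F x * G x) \<in> Hol_C2"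
  by (simp add: Hol_C2_iff holomorphic2_at_mult del: split_paired_All)

lemma weight_join_in_Hol_C2:
  assumes "G \<in> Hol_C2" "H \<in> Hol_C2"
  shows "weight_join G H \<in> Hol_C2"
proof -
  have uv: "(\<lambda>x. fst x * snd x) \<in> Hol_C2"
    by (simp add: Hol_C2_mult)
  have "(\<lambda>x. G (fst x, fst x * snd x)) \<in> Hol_C2" "(\<lambda>x. snd x * H (snd x, fst x * snd x)) \<in> Hol_C2"
    using Hol_C2_compose[OF assms(1) _ uv, of fst] Hol_C2_mult[OF _ Hol_C2_compose[OF assms(2) _ uv, of snd], of snd]
    by simp_all
  from Hol_C2_add[OF this] show ?thesis
    by (simp add: weight_join_def case_prod_unfold plus_fun_def)
qed

text \<open>Any splitting of this shape, however it was found, computes the projections.\<close>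

lemma factors_weight_join:
  assumes "G \<in> Hol_C2" "H \<in> Hol_C2"
  shows "pi_plus (weight_join G H) (u, v) = G (u, u * v)"
    and "pi_minus (weight_join G H) (u, v) = v * H (v, u * v)"
proof -
  note F = weight_join_in_Hol_C2[OF assms]
  let ?G = "plus_factor (weight_join G H)" and ?H = "minus_factor (weight_join G H)"
  have "?G (t * u, u * v) + v / t * ?H (v / t, u * v) = G (t * u, u * v) + v / t * H (v / t, u * v)"
    if "t \<noteq> 0" for t
    using fun_cong[OF weight_join_factors[OF F], of "(t * u, v / t)"] that by (simp add: weight_join_def)
  from weight_split_unique[OF plus_factor_in_Hol_C2[OF F] assms(1) minus_factor_in_Hol_C2[OF F] assms(2) this]
  show "pi_plus (weight_join G H) (u, v) = G (u, u * v)"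
    and "pi_minus (weight_join G H) (u, v) = v * H (v, u * v)"
    by (auto simp: pi_plus_eq pi_minus_eq)
qed

section \<open>Holomorphic functions on open subsets of the product of two spheres\<close>

lemma chart_simps [simp]:
  "chart_fin t = Some t" "chart_inf 0 = None" "t \<noteq> 0 \<Longrightarrow> chart_inf t = Some (1 / t)"
  by (auto simp: chart_fin_def chart_inf_def)

lemma Omega_simps [simp]:
  "(Some z, Some w) \<in> Omega \<longleftrightarrow> z * w \<noteq> 1"
  "(None, Some w) \<in> Omega \<longleftrightarrow> w \<noteq> 0"
  "(Some z, None) \<in> Omega \<longleftrightarrow> z \<noteq> 0"
  "(None, None) \<in> Omega"
  by (auto simp: Omega_def)

lemma Omega_plus_iff: "x \<in> Omega_plus \<longleftrightarrow> x \<in> Omega \<and> snd x \<noteq> None"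
  by (cases x) (auto simp: Omega_plus_def)

lemma Omega_minus_iff: "x \<in> Omega_minus \<longleftrightarrow> x \<in> Omega \<and> fst x \<noteq> None"
  by (cases x) (auto simp: Omega_minus_def)

lemma Omega_chart_simps [simp]:
  "(chart_inf s, Some w) \<in> Omega \<longleftrightarrow> s \<noteq> w"
  "(Some z, chart_inf t) \<in> Omega \<longleftrightarrow> z \<noteq> t"
  "(chart_inf s, chart_inf t) \<in> Omega \<longleftrightarrow> s * t \<noteq> 1"
  by (auto simp: chart_inf_def field_simps)

definition sphere_charts :: "(complex \<Rightarrow> csphere) set" where
  "sphere_charts = {chart_fin, chart_inf}"

definition chart_open :: "(csphere \<times> csphere) set \<Rightarrow> bool" where
  "chart_open U \<longleftrightarrow> (\<forall>\<phi>\<in>sphere_charts. \<forall>\<psi>\<in>sphere_charts. open (map_prod \<phi> \<psi> -` U))"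

lemma vimage_charts_Omega:
  "map_prod chart_fin chart_fin -` Omega = {p. fst p * snd p \<noteq> 1}"
  "map_prod chart_inf chart_fin -` Omega = {p. fst p \<noteq> snd p}"
  "map_prod chart_fin chart_inf -` Omega = {p. fst p \<noteq> snd p}"
  "map_prod chart_inf chart_inf -` Omega = {p. fst p * snd p \<noteq> 1}"
  by (auto simp: vimage_def)

lemma chart_open_Omega: "chart_open Omega"
  unfolding chart_open_def sphere_charts_def
  by (auto simp only: vimage_charts_Omega ball_simps intro!: open_Collect_neq continuous_intros)

lemma open_chart_finite: "\<phi> \<in> sphere_charts \<Longrightarrow> open {t. \<phi> t \<noteq> None}"
proof -
  have "{t. chart_fin t \<noteq> None} = UNIV" "{t. chart_inf t \<noteq> None} = - {0}"
    by (auto simp: chart_inf_def)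
  then show "\<phi> \<in> sphere_charts \<Longrightarrow> open {t. \<phi> t \<noteq> None}"
    unfolding sphere_charts_def by (auto simp del: chart_simps)
qed

lemma chart_open_Omega_plus: "chart_open Omega_plus"
proof -
  have *: "map_prod \<phi> \<psi> -` Omega_plus = map_prod \<phi> \<psi> -` Omega \<inter> (UNIV \<times> {t. \<psi> t \<noteq> None})" for \<phi> \<psi>
    by (auto simp: Omega_plus_iff)
  show ?thesis
    using chart_open_Omega unfolding chart_open_def *
    by (intro ballI open_Int open_Times open_UNIV open_chart_finite) blast+
qed

lemma chart_open_Omega_minus: "chart_open Omega_minus"
proof -
  have *: "map_prod \<phi> \<psi> -` Omega_minus = map_prod \<phi> \<psi> -` Omega \<inter> ({t. \<phi> t \<noteq> None} \<times> UNIV)" for \<phi> \<psi>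
    by (auto simp: Omega_minus_iff)
  show ?thesis
    using chart_open_Omega unfolding chart_open_def *
    by (intro ballI open_Int open_Times open_UNIV open_chart_finite) blast+
qed

lemma holomorphic_csphere2_on_iff:
  assumes "chart_open U"
  shows "f holomorphic_csphere2_on U \<longleftrightarrow>
    (\<forall>\<phi>\<in>sphere_charts. \<forall>\<psi>\<in>sphere_charts. \<forall>p. map_prod \<phi> \<psi> p \<in> U \<longrightarrow> holomorphic2_at (f \<circ> map_prod \<phi> \<psi>) p)"
  unfolding holomorphic_csphere2_on_def sphere_charts_def[symmetric]
proof (intro ball_cong refl)
  fix \<phi> \<psi> assume "\<phi> \<in> sphere_charts" "\<psi> \<in> sphere_charts"
  then have "open (map_prod \<phi> \<psi> -` U)"
    using assms unfolding chart_open_def by blast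
  from holomorphic2_on_open[OF this]
  show "(f \<circ> map_prod \<phi> \<psi>) holomorphic2_on (map_prod \<phi> \<psi> -` U) \<longleftrightarrow>
    (\<forall>p. map_prod \<phi> \<psi> p \<in> U \<longrightarrow> holomorphic2_at (f \<circ> map_prod \<phi> \<psi>) p)"
    unfolding vimage_def by blast
qed

lemma holomorphic_csphere2_on_cong:
  assumes U: "chart_open U" and f: "f holomorphic_csphere2_on U" and eq: "\<And>x. x \<in> U \<Longrightarrow> f x = g x"
  shows "g holomorphic_csphere2_on U"
  unfolding holomorphic_csphere2_on_iff[OF U]
proof (intro ballI allI impI)
  fix \<phi> \<psi> p assume ch: "\<phi> \<in> sphere_charts" "\<psi> \<in> sphere_charts" and p: "map_prod \<phi> \<psi> p \<in> U"
  have o: "open (map_prod \<phi> \<psi> -` U)"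
    using U ch unfolding chart_open_def by blast
  have "holomorphic2_at (f \<circ> map_prod \<phi> \<psi>) p"
    using f ch p unfolding holomorphic_csphere2_on_iff[OF U] by blast
  from holomorphic2_at_transform[OF this o] p show "holomorphic2_at (g \<circ> map_prod \<phi> \<psi>) p"
    using eq by simp
qed

lemma holomorphic_csphere2_on_subset:
  assumes "f holomorphic_csphere2_on U" "V \<subseteq> U" "chart_open U" "chart_open V"
  shows "f holomorphic_csphere2_on V"
  using assms(1,2) unfolding holomorphic_csphere2_on_iff[OF assms(3)] holomorphic_csphere2_on_iff[OF assms(4)]
  by blast

lemma Hol_if:
  assumes "chart_open U" "f holomorphic_csphere2_on U"
  shows "(\<lambda>x. if x \<in> U then f x else 0) \<in> Hol U"
  using holomorphic_csphere2_on_cong[OF assms, of "\<lambda>x. if x \<in> U then f x else 0"] by (auto simp: Hol_def)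

lemma Hol_C2_compose_csphere2:
  assumes U: "chart_open U" and F: "F \<in> Hol_C2" and f: "f holomorphic_csphere2_on U" and g: "g holomorphic_csphere2_on U"
  shows "(\<lambda>x. F (f x, g x)) holomorphic_csphere2_on U"
  unfolding holomorphic_csphere2_on_iff[OF U]
proof (intro ballI allI impI)
  fix \<phi> \<psi> p assume ch: "\<phi> \<in> sphere_charts" "\<psi> \<in> sphere_charts" and p: "map_prod \<phi> \<psi> p \<in> U"
  have "holomorphic2_at (f \<circ> map_prod \<phi> \<psi>) p" "holomorphic2_at (g \<circ> map_prod \<phi> \<psi>) p"
    using f g ch p unfolding holomorphic_csphere2_on_iff[OF U] by blast+
  moreover have "holomorphic2_at F ((f \<circ> map_prod \<phi> \<psi>) p, (g \<circ> map_prod \<phi> \<psi>) p)"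
    using F unfolding Hol_C2_iff by blast
  ultimately show "holomorphic2_at ((\<lambda>x. F (f x, g x)) \<circ> map_prod \<phi> \<psi>) p"
    using holomorphic2_at_compose[of F "f \<circ> map_prod \<phi> \<psi>" p "g \<circ> map_prod \<phi> \<psi>"] by (simp add: o_def)
qed

lemma point_in_chart:
  obtains \<phi> \<psi> p where "\<phi> \<in> sphere_charts" "\<psi> \<in> sphere_charts" "x = map_prod \<phi> \<psi> p"
proof -
  have *: "\<exists>\<phi>\<in>sphere_charts. \<exists>t. z = \<phi> t" for z
    by (cases z) (auto simp: sphere_charts_def chart_fin_def chart_inf_def)
  obtain z w where x: "x = (z, w)" by (cases x)
  obtain \<phi> s \<psi> t where "\<phi> \<in> sphere_charts" "\<psi> \<in> sphere_charts" "z = \<phi> s" "w = \<psi> t"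
    using *[of z] *[of w] by blast
  then show ?thesis
    using that[of \<phi> \<psi> "(s, t)"] x by simp
qed

lemma chart_nonzero_finite:
  assumes "\<phi> \<in> sphere_charts" "t \<noteq> 0"
  obtains z where "\<phi> t = Some z"
  using assms by (auto simp: sphere_charts_def)

text \<open>The finite points are dense: from a point \<open>p\<close> of a chart, move along the diagonal
  direction \<open>p + (t, t)\<close>, which for small \<open>t \<noteq> 0\<close> has both coordinates nonzero and hence
  consists of finite points.\<close>

lemma Hol_eqI:
  assumes U: "chart_open U" and f: "f \<in> Hol U" and g: "g \<in> Hol U"
    and eq: "\<And>z w. (Some z, Some w) \<in> U \<Longrightarrow> f (Some z, Some w) = g (Some z, Some w)"
  shows "f = g"
proof
  fix x
  show "f x = g x"
  proof (cases "x \<in> U")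
    case False
    then show ?thesis
      using f g by (cases x) (simp add: Hol_def)
  next
    case True
    obtain \<phi> \<psi> p where ch: "\<phi> \<in> sphere_charts" "\<psi> \<in> sphere_charts" and x: "x = map_prod \<phi> \<psi> p"
      by (rule point_in_chart)
    define D where "D q = f (map_prod \<phi> \<psi> q) - g (map_prod \<phi> \<psi> q)" for q
    have "holomorphic2_at (f \<circ> map_prod \<phi> \<psi>) p" "holomorphic2_at (g \<circ> map_prod \<phi> \<psi>) p"
      using f g ch True unfolding x Hol_def holomorphic_csphere2_on_iff[OF U] by blast+
    then have "isCont D p"
      using holomorphic2_at_imp_isCont[OF holomorphic2_at_diff] unfolding D_def[abs_def] o_def by blast
    define \<gamma> :: "complex \<Rightarrow> complex \<times> complex" where "\<gamma> t = (fst p + t, snd p + t)" for t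
    have \<gamma>: "(\<gamma> \<longlongrightarrow> p) (at 0)"
      unfolding \<gamma>_def by (cases p) (auto intro!: tendsto_eq_intros)
    have "((\<lambda>t. D (\<gamma> t)) \<longlongrightarrow> D p) (at 0)"
      by (rule isCont_tendsto_compose[OF \<open>isCont D p\<close> \<gamma>])
    moreover have "\<forall>\<^sub>F t in at 0. D (\<gamma> t) = 0"
    proof -
      have o: "open (map_prod \<phi> \<psi> -` U)" "p \<in> map_prod \<phi> \<psi> -` U"
        using U ch True x unfolding chart_open_def by blast+
      have "\<forall>\<^sub>F t in at 0. \<gamma> t \<in> map_prod \<phi> \<psi> -` U"
        using topological_tendstoD[OF \<gamma> o] .
      moreover have "\<forall>\<^sub>F t in at 0. t \<noteq> - fst p" "\<forall>\<^sub>F t in at 0. t \<noteq> - snd p"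
        by (rule eventually_neq_at_within)+
      ultimately show ?thesis
      proof eventually_elim
        case (elim t)
        then have "fst p + t \<noteq> 0" "snd p + t \<noteq> 0"
          by (auto simp: add_eq_0_iff)
        then obtain z w where "\<phi> (fst p + t) = Some z" "\<psi> (snd p + t) = Some w"
          using chart_nonzero_finite ch by metis
        then show ?case
          using elim(1) eq by (simp add: D_def \<gamma>_def)
      qed
    qed
    ultimately have "D p = 0"
      using tendsto_unique[OF at_neq_bot _ tendsto_eventually] by metis
    then show ?thesis
      by (simp add: D_def x)
  qed
qed

lemma extend_fin_eqI:
  assumes "chart_open U" "g \<in> Hol U"
    and "\<And>z w. (Some z, Some w) \<in> U \<Longrightarrow> g (Some z, Some w) = h z w"
  shows "extend_fin U h = g"
  unfolding extend_fin_def using assms by (intro the_equality) (auto intro!: Hol_eqI[OF assms(1)])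

lemma extend_from_eqI:
  assumes "chart_open U" "g \<in> Hol U" "\<And>x. x \<in> D \<Longrightarrow> g x = h x"
    and "\<And>z w. (Some z, Some w) \<in> U \<Longrightarrow> (Some z, Some w) \<in> D"
  shows "extend_from D U h = g"
  unfolding extend_from_def using assms by (intro the_equality) (auto intro!: Hol_eqI[OF assms(1)])

section \<open>Three global coordinates on Omega\<close>

text \<open>On finite points these are \<open>z / (1 - z * w)\<close>, \<open>w / (1 - z * w)\<close> and
  \<open>z * w / (1 - z * w)\<close>, that is \<open>f\<^sub>1\<^sub>0\<close>, \<open>f\<^sub>0\<^sub>1\<close> and \<open>f\<^sub>1\<^sub>1\<close>; they satisfy
  \<open>A * B = C * (C + 1)\<close> and identify \<open>Omega\<close> with that affine quadric. In contrast to \<open>z\<close> and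
  \<open>w\<close> they have no poles on \<open>Omega\<close>.\<close>

fun coord_A :: "csphere \<times> csphere \<Rightarrow> complex" where
  "coord_A (Some z, Some w) = z / (1 - z * w)"
| "coord_A (None, Some w) = - 1 / w"
| "coord_A (_, None) = 0"

fun coord_B :: "csphere \<times> csphere \<Rightarrow> complex" where
  "coord_B (Some z, Some w) = w / (1 - z * w)"
| "coord_B (Some z, None) = - 1 / z"
| "coord_B (None, _) = 0"

fun coord_C :: "csphere \<times> csphere \<Rightarrow> complex" where
  "coord_C (Some z, Some w) = z * w / (1 - z * w)"
| "coord_C _ = - 1"

lemma Omega_holomorphicI:
  assumes "\<And>z w. z * w \<noteq> 1 \<Longrightarrow> f (Some z, Some w) = f1 (z, w)"
    "\<And>s w. s \<noteq> w \<Longrightarrow> f (chart_inf s, Some w) = f2 (s, w)"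
    "\<And>z t. z \<noteq> t \<Longrightarrow> f (Some z, chart_inf t) = f3 (z, t)"
    "\<And>s t. s * t \<noteq> 1 \<Longrightarrow> f (chart_inf s, chart_inf t) = f4 (s, t)"
    "\<And>p. fst p * snd p \<noteq> 1 \<Longrightarrow> holomorphic2_at f1 p"
    "\<And>p. fst p \<noteq> snd p \<Longrightarrow> holomorphic2_at f2 p"
    "\<And>p. fst p \<noteq> snd p \<Longrightarrow> holomorphic2_at f3 p"
    "\<And>p. fst p * snd p \<noteq> 1 \<Longrightarrow> holomorphic2_at f4 p"
  shows "f holomorphic_csphere2_on Omega"
proof -
  have o: "open {p :: complex \<times> complex. fst p \<noteq> snd p}" "open {p :: complex \<times> complex. fst p * snd p \<noteq> 1}"
    by (intro open_Collect_neq continuous_intros)+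
  have "holomorphic2_at (f \<circ> map_prod chart_fin chart_fin) p" if "fst p * snd p \<noteq> 1" for p
    by (rule holomorphic2_at_transform[OF assms(5)[OF that] o(2)]) (use that assms(1) in \<open>auto simp: map_prod_def\<close>)
  moreover have "holomorphic2_at (f \<circ> map_prod chart_inf chart_fin) p" if "fst p \<noteq> snd p" for p
    by (rule holomorphic2_at_transform[OF assms(6)[OF that] o(1)]) (use that assms(2) in \<open>auto simp: map_prod_def\<close>)
  moreover have "holomorphic2_at (f \<circ> map_prod chart_fin chart_inf) p" if "fst p \<noteq> snd p" for p
    by (rule holomorphic2_at_transform[OF assms(7)[OF that] o(1)]) (use that assms(3) in \<open>auto simp: map_prod_def\<close>)
  moreover have "holomorphic2_at (f \<circ> map_prod chart_inf chart_inf) p" if "fst p * snd p \<noteq> 1" for p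
    by (rule holomorphic2_at_transform[OF assms(8)[OF that] o(2)]) (use that assms(4) in \<open>auto simp: map_prod_def\<close>)
  ultimately show ?thesis
    unfolding holomorphic_csphere2_on_iff[OF chart_open_Omega] sphere_charts_def by auto
qed

lemma coord_A_holomorphic: "coord_A holomorphic_csphere2_on Omega"
proof (rule Omega_holomorphicI)
  show "coord_A (Some z, Some w) = (\<lambda>p. fst p / (1 - fst p * snd p)) (z, w)" for z w
    by simp
  show "coord_A (chart_inf s, Some w) = (\<lambda>p. 1 / (fst p - snd p)) (s, w)" if "s \<noteq> w" for s w
    using that by (cases "s = 0") (auto simp: divide_simps)
  show "coord_A (Some z, chart_inf t) = (\<lambda>p. fst p * snd p / (snd p - fst p)) (z, t)" if "z \<noteq> t" for z t
    using that by (cases "t = 0") (auto simp: divide_simps)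
  show "coord_A (chart_inf s, chart_inf t) = (\<lambda>p. snd p / (fst p * snd p - 1)) (s, t)" if "s * t \<noteq> 1" for s t
    using that by (cases "s = 0"; cases "t = 0") (auto simp: divide_simps)
qed (auto intro!: holomorphic2_at_intros)

lemma coord_B_holomorphic: "coord_B holomorphic_csphere2_on Omega"
proof (rule Omega_holomorphicI)
  show "coord_B (Some z, Some w) = (\<lambda>p. snd p / (1 - fst p * snd p)) (z, w)" for z w
    by simp
  show "coord_B (chart_inf s, Some w) = (\<lambda>p. fst p * snd p / (fst p - snd p)) (s, w)" if "s \<noteq> w" for s w
    using that by (cases "s = 0") (auto simp: divide_simps)
  show "coord_B (Some z, chart_inf t) = (\<lambda>p. 1 / (snd p - fst p)) (z, t)" if "z \<noteq> t" for z t
    using that by (cases "t = 0") (auto simp: divide_simps)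
  show "coord_B (chart_inf s, chart_inf t) = (\<lambda>p. fst p / (fst p * snd p - 1)) (s, t)" if "s * t \<noteq> 1" for s t
    using that by (cases "s = 0"; cases "t = 0") (auto simp: divide_simps)
qed (auto intro!: holomorphic2_at_intros)

lemma coord_C_holomorphic: "coord_C holomorphic_csphere2_on Omega"
proof (rule Omega_holomorphicI)
  show "coord_C (Some z, Some w) = (\<lambda>p. fst p * snd p / (1 - fst p * snd p)) (z, w)" for z w
    by simp
  show "coord_C (chart_inf s, Some w) = (\<lambda>p. snd p / (fst p - snd p)) (s, w)" if "s \<noteq> w" for s w
    using that by (cases "s = 0") (auto simp: divide_simps)
  show "coord_C (Some z, chart_inf t) = (\<lambda>p. fst p / (snd p - fst p)) (z, t)" if "z \<noteq> t" for z t
    using that by (cases "t = 0") (auto simp: divide_simps)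
  show "coord_C (chart_inf s, chart_inf t) = (\<lambda>p. 1 / (fst p * snd p - 1)) (s, t)" if "s * t \<noteq> 1" for s t
    using that by (cases "s = 0"; cases "t = 0") (auto simp: divide_simps)
qed (auto intro!: holomorphic2_at_intros)

lemma the_snd_holomorphic: "(\<lambda>x. the (snd x)) holomorphic_csphere2_on Omega_plus"
  unfolding holomorphic_csphere2_on_iff[OF chart_open_Omega_plus]
proof (intro ballI allI impI)
  fix \<phi> \<psi> :: "complex \<Rightarrow> csphere" and p
  assume ch: "\<psi> \<in> sphere_charts" and p: "map_prod \<phi> \<psi> p \<in> Omega_plus"
  show "holomorphic2_at ((\<lambda>x. the (snd x)) \<circ> map_prod \<phi> \<psi>) p"
  proof (cases "\<psi> = chart_fin")
    case True
    then show ?thesis by (simp add: o_def)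
  next
    case False
    then have \<psi>: "\<psi> = chart_inf"
      using ch by (auto simp: sphere_charts_def)
    then have "snd p \<noteq> 0"
      using p by (auto simp: Omega_plus_iff)
    then have h: "holomorphic2_at (\<lambda>p. 1 / snd p) p"
      by (intro holomorphic2_at_intros)
    show ?thesis
      by (rule holomorphic2_at_transform[OF h, of "{p. snd p \<noteq> 0}"])
         (auto simp: \<psi> \<open>snd p \<noteq> 0\<close> intro!: open_Collect_neq continuous_intros)
  qed
qed

lemma the_fst_holomorphic: "(\<lambda>x. the (fst x)) holomorphic_csphere2_on Omega_minus"
  unfolding holomorphic_csphere2_on_iff[OF chart_open_Omega_minus]
proof (intro ballI allI impI)
  fix \<phi> \<psi> :: "complex \<Rightarrow> csphere" and p
  assume ch: "\<phi> \<in> sphere_charts" and p: "map_prod \<phi> \<psi> p \<in> Omega_minus"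
  show "holomorphic2_at ((\<lambda>x. the (fst x)) \<circ> map_prod \<phi> \<psi>) p"
  proof (cases "\<phi> = chart_fin")
    case True
    then show ?thesis by (simp add: o_def)
  next
    case False
    then have \<phi>: "\<phi> = chart_inf"
      using ch by (auto simp: sphere_charts_def)
    then have "fst p \<noteq> 0"
      using p by (auto simp: Omega_minus_iff)
    then have h: "holomorphic2_at (\<lambda>p. 1 / fst p) p"
      by (intro holomorphic2_at_intros)
    show ?thesis
      by (rule holomorphic2_at_transform[OF h, of "{p. fst p \<noteq> 0}"])
         (auto simp: \<phi> \<open>fst p \<noteq> 0\<close> intro!: open_Collect_neq continuous_intros)
  qed
qed

lemma Psi_plus_eq:
  assumes "x \<in> Omega_plus"
  shows "Psi_plus x = (coord_A x, the (snd x))"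
proof -
  have "coord_A holomorphic_csphere2_on Omega_plus"
    by (rule holomorphic_csphere2_on_subset[OF coord_A_holomorphic _ chart_open_Omega chart_open_Omega_plus])
       (auto simp: Omega_plus_def)
  from extend_fin_eqI[OF chart_open_Omega_plus Hol_if[OF chart_open_Omega_plus this]]
    extend_fin_eqI[OF chart_open_Omega_plus Hol_if[OF chart_open_Omega_plus the_snd_holomorphic]]
  show ?thesis
    using assms by (simp add: Psi_plus_def)
qed

lemma Psi_minus_eq:
  assumes "x \<in> Omega_minus"
  shows "Psi_minus x = (the (fst x), coord_B x)"
proof -
  have "coord_B holomorphic_csphere2_on Omega_minus"
    by (rule holomorphic_csphere2_on_subset[OF coord_B_holomorphic _ chart_open_Omega chart_open_Omega_minus])
       (auto simp: Omega_minus_def)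
  from extend_fin_eqI[OF chart_open_Omega_minus Hol_if[OF chart_open_Omega_minus this]]
    extend_fin_eqI[OF chart_open_Omega_minus Hol_if[OF chart_open_Omega_minus the_fst_holomorphic]]
  show ?thesis
    using assms by (simp add: Psi_minus_def)
qed

section \<open>Compactness in Omega\<close>

text \<open>For the chart at infinity: if \<open>V\<close> contains a disc around \<open>0\<close>, then the finite points
  outside \<open>chart_inf ` V\<close> form a closed and bounded set, so \<open>chart_inf ` V\<close> is a neighbourhood of
  infinity in the one-point compactification.\<close>

lemma open_map_charts:
  assumes "\<phi> \<in> sphere_charts" "open V"
  shows "openin csphere_top (\<phi> ` V)"
proof -
  have "openin csphere_top (chart_inf ` V)"
  proof -
    have inv: "open (inverse ` (V - {0}))"
    proof -
      have "inverse ` (V - {0}) = - {0} \<inter> inverse -` V"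
        by (force simp: image_iff)
      also have "open \<dots>"
        using assms(2) by (intro continuous_open_preimage continuous_intros) auto
      finally show ?thesis .
    qed
    show ?thesis
    proof (cases "0 \<in> V")
      case False
      then have "chart_inf ` V = Some ` inverse ` (V - {0})"
        by (force simp: chart_inf_def image_iff inverse_eq_divide)
      then show ?thesis
        using inv by (simp add: csphere_top_def)
    next
      case True
      define C where "C = - inverse ` (V - {0})"
      obtain e where e: "0 < e" "ball 0 e \<subseteq> V"
        using assms(2) True open_contains_ball by blast
      have "cmod z \<le> 1 / e" if "z \<in> C" for z
      proof (rule ccontr)
        assume *: "\<not> cmod z \<le> 1 / e"
        then have "0 < cmod z"
          using e(1) by (meson divide_pos_pos less_trans not_le zero_less_one)
        then have "cmod (inverse z) < e"
          using * e(1) \<open>0 < cmod z\<close> by (simp add: norm_inverse norm_divide divide_simps mult.commute)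
        then have "inverse z \<in> V - {0}"
          using e(2) \<open>0 < cmod z\<close> by auto
        then have "z \<in> inverse ` (V - {0})"
          by (metis imageI inverse_inverse_eq)
        then show False
          using that by (simp add: C_def)
      qed
      then have "compact C"
        unfolding compact_eq_bounded_closed using inv by (auto simp: C_def bounded_iff open_closed)
      moreover have "chart_inf ` V = insert None (Some ` (UNIV - C))"
        using True by (force simp: chart_inf_def image_iff inverse_eq_divide C_def)
      ultimately show ?thesis
        unfolding csphere_top_def openin_Alexandroff_compactification
        by (auto simp: compact_imp_closed)
    qed
  qed
  moreover have "openin csphere_top (chart_fin ` V)"
    using assms(2) by (simp add: csphere_top_def)
  ultimately show ?thesis
    using assms(1) by (auto simp: sphere_charts_def)
qed

text \<open>For the chart at infinity: a neighbourhood of infinity contains all points of modulus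
  greater than some \<open>M\<close>, so its preimage contains the disc of radius \<open>1 / M\<close>.\<close>

lemma open_vimage_chart:
  assumes "\<phi> \<in> sphere_charts" "openin csphere_top W"
  shows "open (\<phi> -` W)"
proof -
  have fin: "open (Some -` W)"
    using openin_continuous_map_preimage[OF continuous_map_Some, of euclidean W] assms(2)
    by (simp add: csphere_top_def vimage_def)
  have "open (- {0} \<inter> (\<lambda>t. 1 / t) -` (Some -` W))"
    using fin by (intro continuous_open_preimage continuous_intros) auto
  also have "- {0} \<inter> (\<lambda>t. 1 / t) -` (Some -` W) = {t. t \<noteq> 0 \<and> 1 / t \<in> Some -` W}"
    by auto
  finally have nz: "open {t. t \<noteq> 0 \<and> 1 / t \<in> Some -` W}" .
  have "open (chart_inf -` W)"
  proof (cases "None \<in> W")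
    case False
    then have "chart_inf -` W = {t. t \<noteq> 0 \<and> 1 / t \<in> Some -` W}"
      by (auto simp: chart_inf_def split: if_splits)
    then show ?thesis
      using nz by simp
  next
    case True
    then obtain C where C: "compact C" "W = insert None (Some ` (UNIV - C))"
      using assms(2) by (auto simp: csphere_top_def openin_Alexandroff_compactification)
    obtain M where M: "M > 0" "\<And>z. z \<in> C \<Longrightarrow> cmod z \<le> M"
      using compact_imp_bounded[OF C(1)] bounded_pos by blast
    have "chart_inf -` W = {t. t \<noteq> 0 \<and> 1 / t \<in> Some -` W} \<union> ball 0 (1 / M)"
    proof -
      have "chart_inf t \<in> W" if "t \<in> ball 0 (1 / M)" for t
      proof (cases "t = 0")
        case False
        have "1 / t \<notin> C"
        proof
          assume "1 / t \<in> C"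
          then have "1 / cmod t \<le> M"
            using M(2)[of "1 / t"] by (simp add: norm_divide)
          then show False
            using that False M(1) by (simp add: field_simps)
        qed
        then show ?thesis
          using False C(2) by simp
      qed (use True in simp)
      moreover have "t = 0 \<or> 1 / t \<in> Some -` W" if "chart_inf t \<in> W" for t
        using that by (cases "t = 0") auto
      moreover have "0 \<in> ball 0 (1 / M)"
        using M(1) by simp
      ultimately show ?thesis
        by (force simp: chart_inf_def)
    qed
    then show ?thesis
      using nz by auto
  qed
  moreover have "open (chart_fin -` W)"
    using fin by (simp add: vimage_def)
  ultimately show ?thesis
    using assms(1) by (auto simp: sphere_charts_def)
qed

abbreviation csphere2_top :: "(csphere \<times> csphere) topology" where
  "csphere2_top \<equiv> prod_topology csphere_top csphere_top"

lemma openin_csphere2_chart_image: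
  assumes "\<phi> \<in> sphere_charts" "\<psi> \<in> sphere_charts" "open V"
  shows "openin csphere2_top (map_prod \<phi> \<psi> ` V)"
  unfolding openin_prod_topology_alt
proof (intro allI impI)
  fix x y assume "(x, y) \<in> map_prod \<phi> \<psi> ` V"
  then obtain s t where st: "(s, t) \<in> V" "x = \<phi> s" "y = \<psi> t"
    by auto
  obtain A B where AB: "open A" "open B" "(s, t) \<in> A \<times> B" "A \<times> B \<subseteq> V"
    using open_prod_elim[OF assms(3) st(1)] by metis
  have "\<phi> ` A \<times> \<psi> ` B = map_prod \<phi> \<psi> ` (A \<times> B)"
    by (rule map_prod_image[symmetric])
  also have "\<dots> \<subseteq> map_prod \<phi> \<psi> ` V"
    using AB(4) by (rule image_mono)
  finally show "\<exists>U W. openin csphere_top U \<and> openin csphere_top W \<and> x \<in> U \<and> y \<in> W \<and> U \<times> W \<subseteq> map_prod \<phi> \<psi> ` V"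
    using AB(3) st(2,3) open_map_charts[OF assms(1) AB(1)] open_map_charts[OF assms(2) AB(2)] by blast
qed

lemma topspace_csphere_top [simp]: "topspace csphere_top = UNIV"
  unfolding csphere_top_def topspace_Alexandroff_compactification
  by (auto simp: image_iff)

text \<open>The preimage of an open set is the union, over the four charts, of images of open sets.\<close>

lemma holomorphic_csphere2_imp_continuous_map:
  assumes f: "f holomorphic_csphere2_on Omega"
  shows "continuous_map (subtopology csphere2_top Omega) euclidean f"
  unfolding continuous_map_def
proof (intro conjI allI impI)
  fix V :: "complex set" assume V: "openin euclidean V"
  define W where "W \<phi> \<psi> = map_prod \<phi> \<psi> -` Omega \<inter> (f \<circ> map_prod \<phi> \<psi>) -` V" for \<phi> \<psi> :: "complex \<Rightarrow> csphere"
  have "open (W \<phi> \<psi>)" if ch: "\<phi> \<in> sphere_charts" "\<psi> \<in> sphere_charts" for \<phi> \<psi>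
    unfolding W_def
  proof (rule continuous_open_preimage)
    have "holomorphic2_at (f \<circ> map_prod \<phi> \<psi>) p" if "p \<in> map_prod \<phi> \<psi> -` Omega" for p
      using f ch that unfolding holomorphic_csphere2_on_iff[OF chart_open_Omega] by blast
    then show "continuous_on (map_prod \<phi> \<psi> -` Omega) (f \<circ> map_prod \<phi> \<psi>)"
      using continuous_at_imp_continuous_on holomorphic2_at_imp_isCont by blast
  qed (use V ch chart_open_Omega in \<open>auto simp: chart_open_def\<close>)
  then have "openin csphere2_top (\<Union>\<phi>\<in>sphere_charts. \<Union>\<psi>\<in>sphere_charts. map_prod \<phi> \<psi> ` W \<phi> \<psi>)"
    by (intro openin_Union ballI) (auto intro!: openin_Union openin_csphere2_chart_image)
  moreover have "(\<Union>\<phi>\<in>sphere_charts. \<Union>\<psi>\<in>sphere_charts. map_prod \<phi> \<psi> ` W \<phi> \<psi>) = {x \<in> Omega. f x \<in> V}"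
  proof (intro equalityI subsetI)
    fix x assume x: "x \<in> {x \<in> Omega. f x \<in> V}"
    obtain \<phi> \<psi> p where ch: "\<phi> \<in> sphere_charts" "\<psi> \<in> sphere_charts" and p: "x = map_prod \<phi> \<psi> p"
      by (rule point_in_chart)
    then have "x \<in> map_prod \<phi> \<psi> ` W \<phi> \<psi>"
      using x by (simp add: W_def)
    then show "x \<in> (\<Union>\<phi>\<in>sphere_charts. \<Union>\<psi>\<in>sphere_charts. map_prod \<phi> \<psi> ` W \<phi> \<psi>)"
      using ch by blast
  qed (auto simp: W_def)
  ultimately show "openin (subtopology csphere2_top Omega) {x \<in> topspace (subtopology csphere2_top Omega). f x \<in> V}"
    unfolding openin_subtopology by (auto simp: topspace_subtopology)
qed simp

lemma compactin_Omega_bounded: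
  assumes "f holomorphic_csphere2_on Omega" "compactin (subtopology csphere2_top Omega) K"
  obtains M where "\<And>x. x \<in> K \<Longrightarrow> cmod (f x) \<le> M"
proof -
  have "compact (f ` K)"
    using image_compactin[OF assms(2) holomorphic_csphere2_imp_continuous_map[OF assms(1)]] by simp
  then obtain M where "\<forall>y\<in>f ` K. cmod y \<le> M"
    using compact_imp_bounded bounded_iff by blast
  then show ?thesis
    using that by blast
qed

section \<open>The inverses of the two coordinate maps\<close>

text \<open>The point of the sphere with homogeneous coordinates \<open>(x : y)\<close>; meaningful unless both
  vanish.\<close>

definition csphere_quotient :: "complex \<Rightarrow> complex \<Rightarrow> csphere" where
  "csphere_quotient x y = (if y = 0 then None else Some (x / y))"

text \<open>Near a point with \<open>g \<noteq> 0\<close> the quotient is read off in the finite chart as \<open>f / g\<close>, and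
  near a point with \<open>f \<noteq> 0\<close> in the chart at infinity as \<open>g / f\<close>.\<close>

lemma continuous_map_csphere_quotient:
  fixes f g :: "complex \<times> complex \<Rightarrow> complex"
  assumes f: "continuous_on UNIV f" and g: "continuous_on UNIV g"
    and nz: "\<And>p. g p = 0 \<Longrightarrow> f p \<noteq> 0"
  shows "continuous_map euclidean csphere_top (\<lambda>p. csphere_quotient (f p) (g p))"
  unfolding continuous_map_def
proof (intro conjI allI impI)
  fix W assume W: "openin csphere_top W"
  have fg: "continuous_on A f" "continuous_on A g" for A
    using f g continuous_on_subset by blast+
  have "open ({p. g p \<noteq> 0} \<inter> (\<lambda>p. f p / g p) -` (chart_fin -` W))"
    by (intro continuous_open_preimage open_Collect_neq open_vimage_chart[OF _ W] continuous_on_divide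
          continuous_on_const fg) (auto simp: sphere_charts_def)
  moreover have "open ({p. f p \<noteq> 0} \<inter> (\<lambda>p. g p / f p) -` (chart_inf -` W))"
    by (intro continuous_open_preimage open_Collect_neq open_vimage_chart[OF _ W] continuous_on_divide
          continuous_on_const fg) (auto simp: sphere_charts_def)
  moreover have "{p. csphere_quotient (f p) (g p) \<in> W} =
      ({p. g p \<noteq> 0} \<inter> (\<lambda>p. f p / g p) -` (chart_fin -` W)) \<union>
      ({p. f p \<noteq> 0} \<inter> (\<lambda>p. g p / f p) -` (chart_inf -` W))"
    using nz by (auto simp: csphere_quotient_def chart_inf_def split: if_splits)
  ultimately show "openin euclidean {p \<in> topspace euclidean. csphere_quotient (f p) (g p) \<in> W}"
    by (simp add: open_Un)
qed simp

text \<open>If \<open>u = z / (1 - z * v)\<close>, then \<open>1 + u * v = 1 / (1 - z * v)\<close> and \<open>z = u / (1 + u * v)\<close>;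
  the points with \<open>1 + u * v = 0\<close> correspond to \<open>z = \<infinity>\<close>.\<close>

definition Psi_plus_inv :: "complex \<times> complex \<Rightarrow> csphere \<times> csphere" where
  "Psi_plus_inv = (\<lambda>(u, v). (csphere_quotient u (1 + u * v), Some v))"

definition Psi_minus_inv :: "complex \<times> complex \<Rightarrow> csphere \<times> csphere" where
  "Psi_minus_inv = (\<lambda>(u, v). (Some u, csphere_quotient v (1 + u * v)))"

lemma coords_Psi_plus_inv:
  "Psi_plus_inv (u, v) \<in> Omega"
  "coord_A (Psi_plus_inv (u, v)) = u"
  "coord_B (Psi_plus_inv (u, v)) = v * (1 + u * v)"
  "coord_C (Psi_plus_inv (u, v)) = u * v"
proof -
  have "Psi_plus_inv (u, v) \<in> Omega \<and> coord_A (Psi_plus_inv (u, v)) = u \<and>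
    coord_B (Psi_plus_inv (u, v)) = v * (1 + u * v) \<and> coord_C (Psi_plus_inv (u, v)) = u * v"
  proof (cases "1 + u * v = 0")
    case True
    then have "u * v = - 1"
      by (simp add: add_eq_0_iff)
    moreover from this have "v \<noteq> 0"
      by auto
    ultimately have "u = - 1 / v" "v \<noteq> 0"
      by (simp_all only: nonzero_eq_divide_eq not_False_eq_True)
    then show ?thesis
      by (simp add: Psi_plus_inv_def csphere_quotient_def)
  next
    case False
    define d where "d = 1 + u * v"
    have d: "d \<noteq> 0" "1 - u * v / d = 1 / d" "u * v / d \<noteq> 1"
      using False by (auto simp: d_def field_simps)
    have "Psi_plus_inv (u, v) = (Some (u / d), Some v)"
      using d by (simp add: Psi_plus_inv_def csphere_quotient_def d_def)
    then show ?thesis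
      using d by (simp flip: d_def)
  qed
  then show "Psi_plus_inv (u, v) \<in> Omega"
  "coord_A (Psi_plus_inv (u, v)) = u"
  "coord_B (Psi_plus_inv (u, v)) = v * (1 + u * v)"
  "coord_C (Psi_plus_inv (u, v)) = u * v"
    by auto
qed

lemma coords_Psi_minus_inv:
  "Psi_minus_inv (u, v) \<in> Omega"
  "coord_A (Psi_minus_inv (u, v)) = u * (1 + u * v)"
  "coord_B (Psi_minus_inv (u, v)) = v"
  "coord_C (Psi_minus_inv (u, v)) = u * v"
proof -
  have "Psi_minus_inv (u, v) \<in> Omega \<and> coord_A (Psi_minus_inv (u, v)) = u * (1 + u * v) \<and>
    coord_B (Psi_minus_inv (u, v)) = v \<and> coord_C (Psi_minus_inv (u, v)) = u * v"
  proof (cases "1 + u * v = 0")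
    case True
    then have "u * v = - 1"
      by (simp add: add_eq_0_iff)
    moreover from this have "u \<noteq> 0"
      by auto
    ultimately have "v = - 1 / u" "u \<noteq> 0"
      by (simp_all only: nonzero_eq_divide_eq not_False_eq_True mult.commute[of v u])
    then show ?thesis
      by (simp add: Psi_minus_inv_def csphere_quotient_def)
  next
    case False
    define d where "d = 1 + u * v"
    have d: "d \<noteq> 0" "1 - u * v / d = 1 / d" "u * v / d \<noteq> 1"
      using False by (auto simp: d_def field_simps)
    have "Psi_minus_inv (u, v) = (Some u, Some (v / d))"
      using d by (simp add: Psi_minus_inv_def csphere_quotient_def d_def)
    then show ?thesis
      using d by (simp flip: d_def)
  qed
  then show "Psi_minus_inv (u, v) \<in> Omega"
  "coord_A (Psi_minus_inv (u, v)) = u * (1 + u * v)"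
  "coord_B (Psi_minus_inv (u, v)) = v"
  "coord_C (Psi_minus_inv (u, v)) = u * v"
    by auto
qed

lemma Psi_plus_inv_coords:
  assumes "x \<in> Omega_plus"
  shows "Psi_plus_inv (coord_A x, the (snd x)) = x"
proof -
  obtain w where w: "snd x = Some w" "x \<in> Omega"
    using assms by (auto simp: Omega_plus_iff)
  show ?thesis
  proof (cases "fst x")
    case None
    then have x: "x = (None, Some w)"
      using w by (simp add: prod_eq_iff)
    then show ?thesis
      using w by (simp add: Psi_plus_inv_def csphere_quotient_def)
  next
    case (Some z)
    then have x: "x = (Some z, Some w)"
      using w by (simp add: prod_eq_iff)
    then have "z * w \<noteq> 1"
      using w by simp
    then have "1 - z * w \<noteq> 0" by simp
    then have "1 + z / (1 - z * w) * w = 1 / (1 - z * w)"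
      by (simp add: field_simps)
    then show ?thesis
      using \<open>1 - z * w \<noteq> 0\<close> by (simp add: x Psi_plus_inv_def csphere_quotient_def)
  qed
qed

lemma Psi_minus_inv_coords:
  assumes "x \<in> Omega_minus"
  shows "Psi_minus_inv (the (fst x), coord_B x) = x"
proof -
  obtain z where z: "fst x = Some z" "x \<in> Omega"
    using assms by (auto simp: Omega_minus_iff)
  show ?thesis
  proof (cases "snd x")
    case None
    then have x: "x = (Some z, None)"
      using z by (simp add: prod_eq_iff)
    then show ?thesis
      using z by (simp add: Psi_minus_inv_def csphere_quotient_def)
  next
    case (Some w)
    then have x: "x = (Some z, Some w)"
      using z by (simp add: prod_eq_iff)
    then have "z * w \<noteq> 1"
      using z by simp
    then have "1 - z * w \<noteq> 0" by simp
    then have "1 + z * (w / (1 - z * w)) = 1 / (1 - z * w)"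
      by (simp add: field_simps)
    then show ?thesis
      using \<open>1 - z * w \<noteq> 0\<close> by (simp add: x Psi_minus_inv_def csphere_quotient_def)
  qed
qed

lemma inv_into_Psi_plus: "inv_into Omega_plus Psi_plus = Psi_plus_inv"
proof
  fix p :: "complex \<times> complex"
  obtain u v where p: "p = (u, v)" by (cases p)
  show "inv_into Omega_plus Psi_plus p = Psi_plus_inv p"
  proof (rule inv_into_f_eq)
    show "inj_on Psi_plus Omega_plus"
      by (rule inj_on_inverseI[of _ Psi_plus_inv]) (simp add: Psi_plus_eq Psi_plus_inv_coords)
    show "Psi_plus_inv p \<in> Omega_plus"
      by (simp add: Omega_plus_iff p coords_Psi_plus_inv) (simp add: Psi_plus_inv_def)
    then show "Psi_plus (Psi_plus_inv p) = p"
      by (simp add: Psi_plus_eq p coords_Psi_plus_inv) (simp add: Psi_plus_inv_def)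
  qed
qed

lemma inv_into_Psi_minus: "inv_into Omega_minus Psi_minus = Psi_minus_inv"
proof
  fix p :: "complex \<times> complex"
  obtain u v where p: "p = (u, v)" by (cases p)
  show "inv_into Omega_minus Psi_minus p = Psi_minus_inv p"
  proof (rule inv_into_f_eq)
    show "inj_on Psi_minus Omega_minus"
      by (rule inj_on_inverseI[of _ Psi_minus_inv]) (simp add: Psi_minus_eq Psi_minus_inv_coords)
    show "Psi_minus_inv p \<in> Omega_minus"
      by (simp add: Omega_minus_iff p coords_Psi_minus_inv) (simp add: Psi_minus_inv_def)
    then show "Psi_minus (Psi_minus_inv p) = p"
      by (simp add: Psi_minus_eq p coords_Psi_minus_inv) (simp add: Psi_minus_inv_def)
  qed
qed

lemma continuous_map_Psi_plus_inv:
  "continuous_map euclidean (subtopology csphere2_top Omega) Psi_plus_inv"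
proof -
  have "continuous_map euclidean csphere_top (\<lambda>p. csphere_quotient (fst p) (1 + fst p * snd p))"
    by (rule continuous_map_csphere_quotient) (auto intro!: continuous_intros)
  moreover have "continuous_map euclidean csphere_top (\<lambda>p :: complex \<times> complex. csphere_quotient (snd p) 1)"
    by (rule continuous_map_csphere_quotient) (auto intro!: continuous_intros)
  ultimately have "continuous_map euclidean csphere2_top Psi_plus_inv"
    by (simp add: continuous_map_pairwise o_def Psi_plus_inv_def case_prod_unfold csphere_quotient_def)
  then show ?thesis
    by (auto simp: continuous_map_in_subtopology coords_Psi_plus_inv)
qed

lemma continuous_map_Psi_minus_inv:
  "continuous_map euclidean (subtopology csphere2_top Omega) Psi_minus_inv"
proof -
  have "continuous_map euclidean csphere_top (\<lambda>p. csphere_quotient (snd p) (1 + fst p * snd p))"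
    by (rule continuous_map_csphere_quotient) (auto intro!: continuous_intros)
  moreover have "continuous_map euclidean csphere_top (\<lambda>p :: complex \<times> complex. csphere_quotient (fst p) 1)"
    by (rule continuous_map_csphere_quotient) (auto intro!: continuous_intros)
  ultimately have "continuous_map euclidean csphere2_top Psi_minus_inv"
    by (simp add: continuous_map_pairwise o_def Psi_minus_inv_def case_prod_unfold csphere_quotient_def)
  then show ?thesis
    by (auto simp: continuous_map_in_subtopology coords_Psi_minus_inv)
qed

lemma holomorphic2_at_through_charts:
  assumes f: "f holomorphic_csphere2_on Omega" and Om: "E p \<in> Omega" and U: "open U" "p \<in> U"
    and ch: "\<phi> \<in> sphere_charts" "\<psi> \<in> sphere_charts"
    and gh: "holomorphic2_at g p" "holomorphic2_at h p"
    and eq: "\<And>x. x \<in> U \<Longrightarrow> map_prod \<phi> \<psi> (g x, h x) = E x"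
  shows "holomorphic2_at (f \<circ> E) p"
proof -
  have "map_prod \<phi> \<psi> (g p, h p) \<in> Omega"
    using eq[OF U(2)] Om by simp
  then have "holomorphic2_at (f \<circ> map_prod \<phi> \<psi>) (g p, h p)"
    using f ch unfolding holomorphic_csphere2_on_iff[OF chart_open_Omega] by blast
  from holomorphic2_at_compose[OF this gh] show ?thesis
    by (rule holomorphic2_at_transform[OF _ U]) (use eq in simp)
qed

lemma pullback_plus_in_Hol_C2:
  assumes f: "f holomorphic_csphere2_on Omega"
  shows "f \<circ> Psi_plus_inv \<in> Hol_C2"
  unfolding Hol_C2_iff
proof
  fix p :: "complex \<times> complex"
  have Om: "Psi_plus_inv p \<in> Omega"
    by (cases p) (simp add: coords_Psi_plus_inv)
  show "holomorphic2_at (f \<circ> Psi_plus_inv) p"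
  proof (cases "1 + fst p * snd p = 0")
    case False
    show ?thesis
      by (rule holomorphic2_at_through_charts[where p = p and E = Psi_plus_inv and g = "\<lambda>p. fst p / (1 + fst p * snd p)" and h = snd and \<phi> = chart_fin and \<psi> = chart_fin
            and U = "{p. 1 + fst p * snd p \<noteq> 0}", OF f Om])
         (use False in \<open>auto intro!: holomorphic2_at_intros open_Collect_neq continuous_intros
            simp: Psi_plus_inv_def csphere_quotient_def sphere_charts_def\<close>)
  next
    case True
    then have "fst p \<noteq> 0" by auto
    then show ?thesis
      by (intro holomorphic2_at_through_charts[where p = p and E = Psi_plus_inv and g = "\<lambda>p. (1 + fst p * snd p) / fst p" and h = snd and \<phi> = chart_inf and \<psi> = chart_fin
            and U = "{p. fst p \<noteq> 0}", OF f Om])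
         (auto intro!: holomorphic2_at_intros open_Collect_neq continuous_intros
            simp: Psi_plus_inv_def csphere_quotient_def sphere_charts_def chart_inf_def)
  qed
qed

lemma pullback_minus_in_Hol_C2:
  assumes f: "f holomorphic_csphere2_on Omega"
  shows "f \<circ> Psi_minus_inv \<in> Hol_C2"
  unfolding Hol_C2_iff
proof
  fix p :: "complex \<times> complex"
  have Om: "Psi_minus_inv p \<in> Omega"
    by (cases p) (simp add: coords_Psi_minus_inv)
  show "holomorphic2_at (f \<circ> Psi_minus_inv) p"
  proof (cases "1 + fst p * snd p = 0")
    case False
    show ?thesis
      by (rule holomorphic2_at_through_charts[where p = p and E = Psi_minus_inv and h = "\<lambda>p. snd p / (1 + fst p * snd p)" and g = fst and \<phi> = chart_fin and \<psi> = chart_fin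
            and U = "{p. 1 + fst p * snd p \<noteq> 0}", OF f Om])
         (use False in \<open>auto intro!: holomorphic2_at_intros open_Collect_neq continuous_intros
            simp: Psi_minus_inv_def csphere_quotient_def sphere_charts_def\<close>)
  next
    case True
    then have "snd p \<noteq> 0" by auto
    then show ?thesis
      by (intro holomorphic2_at_through_charts[where p = p and E = Psi_minus_inv and h = "\<lambda>p. (1 + fst p * snd p) / snd p" and g = fst and \<phi> = chart_fin and \<psi> = chart_inf
            and U = "{p. snd p \<noteq> 0}", OF f Om])
         (auto intro!: holomorphic2_at_intros open_Collect_neq continuous_intros
            simp: Psi_minus_inv_def csphere_quotient_def sphere_charts_def chart_inf_def)
  qed
qed

section \<open>The map Phi and its inverse\<close>

definition sphere_join :: "(complex \<times> complex \<Rightarrow> complex) \<Rightarrow> (complex \<times> complex \<Rightarrow> complex) \<Rightarrow>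
    csphere \<times> csphere \<Rightarrow> complex" where
  "sphere_join G H x =
     (if x \<in> Omega then G (coord_A x, coord_C x) + coord_B x * H (coord_B x, coord_C x) else 0)"

lemma weight_join_apply: "weight_join G H (u, v) = G (u, u * v) + v * H (v, u * v)"
  by (simp add: weight_join_def)

lemma plus_part_holomorphic:
  "G \<in> Hol_C2 \<Longrightarrow> (\<lambda>x. G (coord_A x, coord_C x)) holomorphic_csphere2_on Omega"
  by (intro Hol_C2_compose_csphere2 chart_open_Omega coord_A_holomorphic coord_C_holomorphic)

lemma minus_part_holomorphic:
  assumes "H \<in> Hol_C2"
  shows "(\<lambda>x. coord_B x * H (coord_B x, coord_C x)) holomorphic_csphere2_on Omega"
proof -
  have "(\<lambda>x. fst x * H (fst x, snd x)) \<in> Hol_C2"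
    using Hol_C2_mult[OF Hol_C2_const_fst_snd(2) assms] by simp
  from Hol_C2_compose_csphere2[OF chart_open_Omega this coord_B_holomorphic coord_C_holomorphic]
  show ?thesis
    by simp
qed

lemma sphere_join_in_Hol:
  assumes "G \<in> Hol_C2" "H \<in> Hol_C2"
  shows "sphere_join G H \<in> Hol Omega"
proof -
  have "(\<lambda>x. fst x + snd x) \<in> Hol_C2"
    by (simp add: Hol_C2_iff holomorphic2_at_add del: split_paired_All)
  from Hol_C2_compose_csphere2[OF chart_open_Omega this plus_part_holomorphic[OF assms(1)] minus_part_holomorphic[OF assms(2)]]
  show ?thesis
    unfolding sphere_join_def[abs_def] by (intro Hol_if chart_open_Omega) simp
qed

text \<open>On \<open>Omega_plus\<close> the future part of \<open>F \<circ> Psi_plus\<close> is \<open>G (A, A * w) = G (A, C)\<close>, whose right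
  hand side is holomorphic on all of \<open>Omega\<close>; likewise the past part on \<open>Omega_minus\<close>.\<close>

lemma Phi_weight_join:
  assumes G: "G \<in> Hol_C2" and H: "H \<in> Hol_C2"
  shows "Phi (weight_join G H) = sphere_join G H"
proof -
  let ?F = "weight_join G H"
  have "Phi_plus (pi_plus ?F) = (\<lambda>x. if x \<in> Omega then G (coord_A x, coord_C x) else 0)"
    unfolding Phi_plus_def
  proof (rule extend_from_eqI[OF chart_open_Omega])
    fix x assume x: "x \<in> Omega_plus"
    then obtain w where w: "snd x = Some w" "x \<in> Omega"
      by (auto simp: Omega_plus_iff)
    then have "coord_A x * w = coord_C x"
      by (cases x; cases "fst x") auto
    then show "(if x \<in> Omega then G (coord_A x, coord_C x) else 0) = (pi_plus ?F \<circ> Psi_plus) x"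
      using w x by (simp add: Psi_plus_eq factors_weight_join[OF G H])
  qed (use Hol_if[OF chart_open_Omega plus_part_holomorphic[OF G]] in \<open>auto simp: Omega_plus_iff\<close>)
  moreover have "Phi_minus (pi_minus ?F) = (\<lambda>x. if x \<in> Omega then coord_B x * H (coord_B x, coord_C x) else 0)"
    unfolding Phi_minus_def
  proof (rule extend_from_eqI[OF chart_open_Omega])
    fix x assume x: "x \<in> Omega_minus"
    then obtain z where z: "fst x = Some z" "x \<in> Omega"
      by (auto simp: Omega_minus_iff)
    then have "z * coord_B x = coord_C x"
      by (cases x; cases "snd x") auto
    then show "(if x \<in> Omega then coord_B x * H (coord_B x, coord_C x) else 0) = (pi_minus ?F \<circ> Psi_minus) x"
      using z x by (simp add: Psi_minus_eq factors_weight_join[OF G H])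
  qed (use Hol_if[OF chart_open_Omega minus_part_holomorphic[OF H]] in \<open>auto simp: Omega_minus_iff\<close>)
  ultimately show ?thesis
    by (auto simp: Phi_def sphere_join_def fun_eq_iff)
qed

lemma Phi_eq: "F \<in> Hol_C2 \<Longrightarrow> Phi F = sphere_join (plus_factor F) (minus_factor F)"
  using Phi_weight_join[OF plus_factor_in_Hol_C2 minus_factor_in_Hol_C2, of F F] weight_join_factors[of F] by simp

lemma Hol_C2_weight_joinE:
  assumes "F \<in> Hol_C2"
  obtains G H where "G \<in> Hol_C2" "H \<in> Hol_C2" "F = weight_join G H"
  using that[OF plus_factor_in_Hol_C2[OF assms] minus_factor_in_Hol_C2[OF assms]] weight_join_factors[OF assms] by simp

lemma Phi_in_Hol: "F \<in> Hol_C2 \<Longrightarrow> Phi F \<in> Hol Omega"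
  by (simp add: Phi_eq sphere_join_in_Hol plus_factor_in_Hol_C2 minus_factor_in_Hol_C2)

definition Phi_inv :: "(csphere \<times> csphere \<Rightarrow> complex) \<Rightarrow> complex \<times> complex \<Rightarrow> complex" where
  "Phi_inv f = pi_plus (f \<circ> Psi_plus_inv) + pi_minus (f \<circ> Psi_minus_inv)"

text \<open>The pullbacks of \<open>Phi F\<close> split as \<open>(G, H')\<close> and \<open>(G', H)\<close>, where \<open>H'\<close> arises from
  \<open>B = v * (1 + u * v)\<close> and \<open>G'\<close> from \<open>A = u * (1 + u * v)\<close>; the projections keep \<open>G\<close> and \<open>H\<close>.\<close>

lemma Phi_inv_Phi:
  assumes "F \<in> Hol_C2"
  shows "Phi_inv (Phi F) = F"
proof -
  obtain G H where G: "G \<in> Hol_C2" and H: "H \<in> Hol_C2" and F: "F = weight_join G H"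
    using Hol_C2_weight_joinE[OF assms] .
  define G' where "G' = (\<lambda>x. G (fst x * (1 + snd x), snd x))"
  define H' where "H' = (\<lambda>x. (1 + snd x) * H (fst x * (1 + snd x), snd x))"
  have s: "(\<lambda>x. 1 + snd x) \<in> Hol_C2"
    using Hol_C2_add[of "\<lambda>x. 1" snd] by (simp add: plus_fun_def)
  have G': "G' \<in> Hol_C2" and H': "H' \<in> Hol_C2"
    unfolding G'_def H'_def by (intro Hol_C2_compose[OF G] Hol_C2_compose[OF H] Hol_C2_mult s Hol_C2_const_fst_snd)+
  have PF: "Phi F = sphere_join G H"
    by (simp add: F Phi_weight_join G H)
  have "Phi F \<circ> Psi_plus_inv = weight_join G H'"
    by (auto simp: PF sphere_join_def coords_Psi_plus_inv weight_join_apply H'_def fun_eq_iff mult.assoc)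
  moreover have "Phi F \<circ> Psi_minus_inv = weight_join G' H"
    by (auto simp: PF sphere_join_def coords_Psi_minus_inv weight_join_apply G'_def fun_eq_iff)
  ultimately have "Phi_inv (Phi F) = pi_plus (weight_join G H') + pi_minus (weight_join G' H)"
    unfolding Phi_inv_def by simp
  also have "\<dots> = F"
    by (auto simp: F weight_join_apply factors_weight_join G H G' H' fun_eq_iff)
  finally show ?thesis .
qed

text \<open>Evaluating \<open>f\<close> along the curve \<open>t \<mapsto> (t * z, w / t)\<close> in both coordinate systems and
  comparing powers of \<open>t\<close> shows that the future parts of the two pullbacks are the same function
  on \<open>Omega\<close>, so that they fit together with the other past part.\<close>

lemma Phi_inv_right_inverse:
  assumes f: "f \<in> Hol Omega"
  shows "Phi_inv f \<in> Hol_C2" and "Phi (Phi_inv f) = f"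
proof -
  have hol: "f holomorphic_csphere2_on Omega"
    using f by (simp add: Hol_def)
  obtain G H where G: "G \<in> Hol_C2" and H: "H \<in> Hol_C2" and p: "f \<circ> Psi_plus_inv = weight_join G H"
    using Hol_C2_weight_joinE[OF pullback_plus_in_Hol_C2[OF hol]] .
  obtain G' H' where G': "G' \<in> Hol_C2" and H': "H' \<in> Hol_C2" and m: "f \<circ> Psi_minus_inv = weight_join G' H'"
    using Hol_C2_weight_joinE[OF pullback_minus_in_Hol_C2[OF hol]] .
  have inv: "Phi_inv f = weight_join G H'"
    by (auto simp: Phi_inv_def p m factors_weight_join G H G' H' weight_join_apply fun_eq_iff)
  then show "Phi_inv f \<in> Hol_C2"
    by (simp add: weight_join_in_Hol_C2 G H')
  have "sphere_join G H' = f"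
  proof (rule Hol_eqI[OF chart_open_Omega sphere_join_in_Hol[OF G H'] f])
    fix z w assume "(Some z, Some w) \<in> Omega"
    then have zw: "z * w \<noteq> 1" by simp
    \<comment> \<open>With this abbreviation \<open>A = z / d\<close>, \<open>B = w / d\<close> and \<open>C = z * w / d\<close>.\<close>
    define d where "d = 1 - z * w"
    have d: "d \<noteq> 0" "1 + z * w / d = 1 / d"
      using zw by (auto simp: d_def field_simps)
    have plus: "f (Some (t * z), Some (w / t)) = G (t * (z / d), z * w / d) + w / t * H (w / t, z * w / d)" if "t \<noteq> 0" for t
      using fun_cong[OF p, of "(t * (z / d), w / t)"] that d
      by (simp add: Psi_plus_inv_def csphere_quotient_def weight_join_apply)
    have minus: "f (Some (t * z), Some (w / t)) = G' (t * z, z * w / d) + w / d / t * H' (w / d / t, z * w / d)" if "t \<noteq> 0" for t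
      using fun_cong[OF m, of "(t * z, w / d / t)"] that d
      by (simp add: Psi_minus_inv_def csphere_quotient_def weight_join_apply)
    have "G (t * (z / d), z * w / d) + w / t * H (w / t, z * w / d) =
        G' (t * z, z * w / d) + (w / d) / t * H' (w / d / t, z * w / d)" if "t \<noteq> 0" for t
      using plus[OF that] minus[OF that] by (rule trans[OF sym])
    from weight_split_unique(1)[OF G G' H H' this]
    have "G (z / d, z * w / d) = G' (z, z * w / d)" .
    then show "sphere_join G H' (Some z, Some w) = f (Some z, Some w)"
      using minus[of 1] zw by (simp add: sphere_join_def d_def)
  qed
  then show "Phi (Phi_inv f) = f"
    by (simp add: inv Phi_weight_join G H')
qed

lemma bij_betw_Phi: "bij_betw Phi Hol_C2 (Hol Omega)"
  by (rule bij_betw_byWitness[where f' = Phi_inv]) (auto simp: Phi_inv_Phi Phi_inv_right_inverse Phi_in_Hol)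

lemma inv_into_Phi: "f \<in> Hol Omega \<Longrightarrow> inv_into Hol_C2 Phi f = Phi_inv f"
  using bij_betw_Phi Phi_inv_right_inverse[of f] by (intro inv_into_f_eq) (auto simp: bij_betw_def)

lemma clinear_on_Phi: "clinear_on Hol_C2 Phi"
  unfolding clinear_on_def
proof (intro conjI ballI allI)
  fix F F' assume F: "F \<in> Hol_C2" and F': "F' \<in> Hol_C2"
  obtain G H where GH: "G \<in> Hol_C2" "H \<in> Hol_C2" and F: "F = weight_join G H"
    using F by (rule Hol_C2_weight_joinE)
  obtain G' H' where GH': "G' \<in> Hol_C2" "H' \<in> Hol_C2" and F': "F' = weight_join G' H'"
    using F' by (rule Hol_C2_weight_joinE)
  have "F + F' = weight_join (G + G') (H + H')"
    by (auto simp: F F' weight_join_apply fun_eq_iff algebra_simps)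
  then have "Phi (F + F') = sphere_join (G + G') (H + H')"
    using Phi_weight_join Hol_C2_add GH GH' by simp
  then show "Phi (F + F') = Phi F + Phi F'"
    unfolding F F' Phi_weight_join[OF GH] Phi_weight_join[OF GH'] by (auto simp: sphere_join_def fun_eq_iff algebra_simps)
next
  fix c F assume "F \<in> Hol_C2"
  then obtain G H where GH: "G \<in> Hol_C2" "H \<in> Hol_C2" and F: "F = weight_join G H"
    by (rule Hol_C2_weight_joinE)
  have "cscale c F = weight_join (cscale c G) (cscale c H)"
    by (auto simp: F weight_join_apply cscale_def fun_eq_iff algebra_simps)
  then have "Phi (cscale c F) = sphere_join (cscale c G) (cscale c H)"
    using Phi_weight_join Hol_C2_cscale GH by simp
  then show "Phi (cscale c F) = cscale c (Phi F)"
    unfolding F Phi_weight_join[OF GH] by (auto simp: sphere_join_def cscale_def fun_eq_iff algebra_simps)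
qed

lemma Hol_Omega_add:
  assumes "f \<in> Hol Omega" "g \<in> Hol Omega"
  shows "f + g \<in> Hol Omega"
proof -
  have "f + g = Phi (Phi_inv f + Phi_inv g)"
    using clinear_on_Phi Phi_inv_right_inverse assms by (simp add: clinear_on_def)
  then show ?thesis
    by (simp add: Phi_in_Hol Hol_C2_add Phi_inv_right_inverse assms)
qed

lemma Hol_Omega_cscale:
  assumes "f \<in> Hol Omega"
  shows "cscale c f \<in> Hol Omega"
proof -
  have "cscale c f = Phi (cscale c (Phi_inv f))"
    using clinear_on_Phi Phi_inv_right_inverse assms by (simp add: clinear_on_def)
  then show ?thesis
    by (simp add: Phi_in_Hol Hol_C2_cscale Phi_inv_right_inverse assms)
qed

lemma clinear_on_Phi_inv: "clinear_on (Hol Omega) Phi_inv"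
  unfolding clinear_on_def
proof (intro conjI ballI allI)
  fix f g assume fg: "f \<in> Hol Omega" "g \<in> Hol Omega"
  have "f + g = Phi (Phi_inv f + Phi_inv g)"
    using clinear_on_Phi Phi_inv_right_inverse fg by (simp add: clinear_on_def)
  then show "Phi_inv (f + g) = Phi_inv f + Phi_inv g"
    by (simp add: Phi_inv_Phi Hol_C2_add Phi_inv_right_inverse fg)
next
  fix c f assume f: "f \<in> Hol Omega"
  have "cscale c f = Phi (cscale c (Phi_inv f))"
    using clinear_on_Phi Phi_inv_right_inverse f by (simp add: clinear_on_def)
  then show "Phi_inv (cscale c f) = cscale c (Phi_inv f)"
    by (simp add: Phi_inv_Phi Hol_C2_cscale Phi_inv_right_inverse f)
qed

section \<open>Continuity in the topology of locally uniform convergence\<close>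

text \<open>By linearity, \<open>T g - T f\<close> is \<open>T (g - f)\<close>, so bounds of \<open>T\<close> by suprema over compact sets
  give continuity at every \<open>f\<close> at once.\<close>

lemma continuous_map_loc_unif:
  assumes lin: "clinear_on H T" and T: "T ` H \<subseteq> H'"
    and H: "\<And>f g. f \<in> H \<Longrightarrow> g \<in> H \<Longrightarrow> f + g \<in> H" "\<And>c f. f \<in> H \<Longrightarrow> cscale c f \<in> H"
    and bound: "\<And>K. compactin Y K \<Longrightarrow> \<exists>L c. compactin X L \<and> 0 < c \<and>
      (\<forall>f\<in>H. \<forall>M. (\<forall>x\<in>L. cmod (f x) \<le> M) \<longrightarrow> (\<forall>y\<in>K. cmod (T f y) \<le> c * M))"
  shows "continuous_map (loc_unif_topology X H) (loc_unif_topology Y H') T"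
  unfolding continuous_map_def
proof (intro conjI allI impI)
  show "T \<in> topspace (loc_unif_topology X H) \<rightarrow> topspace (loc_unif_topology Y H')"
    using T by auto
  fix V assume V: "openin (loc_unif_topology Y H') V"
  show "openin (loc_unif_topology X H) {f \<in> topspace (loc_unif_topology X H). T f \<in> V}"
    unfolding openin_loc_unif_topology topspace_loc_unif_topology
  proof (intro conjI ballI)
    fix f assume "f \<in> {f \<in> H. T f \<in> V}"
    then have f: "f \<in> H" "T f \<in> V" by auto
    then obtain K e where K: "compactin Y K" "0 < e"
      and sub: "{g \<in> H'. \<forall>y\<in>K. cmod (g y - T f y) < e} \<subseteq> V"
      using V unfolding openin_loc_unif_topology by blast
    obtain L c where L: "compactin X L" "0 < c"
      and b: "\<And>f M. f \<in> H \<Longrightarrow> (\<forall>x\<in>L. cmod (f x) \<le> M) \<Longrightarrow> (\<forall>y\<in>K. cmod (T f y) \<le> c * M)"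
      using bound[OF K(1)] by blast
    have "T g \<in> V" if g: "g \<in> H" "\<forall>x\<in>L. cmod (g x - f x) < e / (2 * c)" for g
    proof -
      define h where "h = g + cscale (- 1) f"
      have f': "cscale (- 1) f \<in> H"
        using H f by blast
      then have h: "h \<in> H"
        unfolding h_def by (rule H(1)[OF g(1)])
      have "T h = T g + cscale (- 1) (T f)"
        unfolding h_def using lin g(1) f(1) f' unfolding clinear_on_def by metis
      then have Th: "T g y - T f y = T h y" for y
        by (simp add: cscale_def)
      have "\<forall>x\<in>L. cmod (h x) \<le> e / (2 * c)"
        using g(2) by (auto simp: h_def cscale_def intro: less_imp_le)
      from b[OF h this] have "\<forall>y\<in>K. cmod (T h y) \<le> e / 2"
        using L(2) by simp
      then have "\<forall>y\<in>K. cmod (T g y - T f y) < e"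
        unfolding Th using K(2) by fastforce
      then show ?thesis
        using sub T g(1) by blast
    qed
    then show "\<exists>L e. compactin X L \<and> 0 < e \<and> {g \<in> H. \<forall>x\<in>L. cmod (g x - f x) < e} \<subseteq> {f \<in> H. T f \<in> V}"
      using L K(2) by (intro exI[of _ L] exI[of _ "e / (2 * c)"]) auto
  qed auto
qed

lemma continuous_map_Phi: "continuous_map Hol_C2_top Hol_Omega_top Phi"
proof (rule continuous_map_loc_unif[OF clinear_on_Phi])
  fix K assume K: "compactin (subtopology csphere2_top Omega) K"
  obtain a b c where abc: "\<And>x. x \<in> K \<Longrightarrow> cmod (coord_A x) \<le> a"
    "\<And>x. x \<in> K \<Longrightarrow> cmod (coord_B x) \<le> b" "\<And>x. x \<in> K \<Longrightarrow> cmod (coord_C x) \<le> c"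
    using compactin_Omega_bounded[OF coord_A_holomorphic K] compactin_Omega_bounded[OF coord_B_holomorphic K]
      compactin_Omega_bounded[OF coord_C_holomorphic K] by metis
  define R where "R = max 1 (max a (max b c))"
  have R: "1 \<le> R" and abcR: "\<And>x. x \<in> K \<Longrightarrow> cmod (coord_A x) \<le> R \<and> cmod (coord_B x) \<le> R \<and> cmod (coord_C x) \<le> R"
    using abc by (auto simp: R_def le_max_iff_disj)
  define L :: "(complex \<times> complex) set" where "L = cball 0 (2 * R) \<times> cball 0 (2 * R)"
  have "cmod (Phi F x) \<le> (4 + 4 * R) * M" if F: "F \<in> Hol_C2" and M: "\<forall>p\<in>L. cmod (F p) \<le> M" and x: "x \<in> K" for F M x
  proof -
    have M': "cmod (F (u, v)) \<le> M" if "cmod u \<le> 2 * R" "cmod v \<le> 2 * R" for u v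
      using M that by (simp add: L_def)
    have "x \<in> Omega"
      using K x compactin_subset_topspace by fastforce
    then have "cmod (Phi F x) \<le> cmod (plus_factor F (coord_A x, coord_C x)) + cmod (coord_B x) * cmod (minus_factor F (coord_B x, coord_C x))"
      by (simp add: Phi_eq F sphere_join_def norm_triangle_le norm_mult)
    also have "\<dots> \<le> 4 * M + R * (4 * M)"
      using abcR[OF x] R by (intro add_mono mult_mono factor_bounds[OF F R M']) auto
    finally show ?thesis
      by (simp add: algebra_simps)
  qed
  moreover have "compactin euclidean L"
    by (simp add: L_def compact_Times)
  moreover have "0 < 4 + 4 * R"
    using R by simp
  ultimately show "\<exists>L c. compactin euclidean L \<and> 0 < c \<and>
      (\<forall>f\<in>Hol_C2. \<forall>M. (\<forall>x\<in>L. cmod (f x) \<le> M) \<longrightarrow> (\<forall>y\<in>K. cmod (Phi f y) \<le> c * M))"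
    by blast
qed (auto simp: Phi_in_Hol Hol_C2_add Hol_C2_cscale)

lemma continuous_map_Phi_inv: "continuous_map Hol_Omega_top Hol_C2_top Phi_inv"
proof (rule continuous_map_loc_unif[OF clinear_on_Phi_inv])
  fix K :: "(complex \<times> complex) set" assume "compactin euclidean K"
  then obtain r where r: "\<And>p. p \<in> K \<Longrightarrow> norm p \<le> r"
    using compact_imp_bounded bounded_iff by (metis compactin_euclidean_iff)
  define R where "R = max 1 r"
  \<comment> \<open>A radius of at least \<open>1\<close> makes \<open>R\<^sup>2\<close> bound \<open>u\<close> and \<open>v\<close> as well as \<open>u * v\<close>.\<close>
  have "1 \<le> R"
    by (simp add: R_def)
  then have R: "1 \<le> R" "R \<le> R\<^sup>2"
    using mult_left_mono[of 1 R R] by (auto simp: power2_eq_square)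
  have R2: "1 \<le> R\<^sup>2"
    using R by linarith
  define D :: "(complex \<times> complex) set" where "D = cball 0 (2 * R\<^sup>2) \<times> cball 0 (2 * R\<^sup>2)"
  define L where "L = Psi_plus_inv ` D \<union> Psi_minus_inv ` D"
  have "compactin (subtopology csphere2_top Omega) L"
    unfolding L_def
    by (intro compactin_Un image_compactin[OF _ continuous_map_Psi_plus_inv] image_compactin[OF _ continuous_map_Psi_minus_inv])
       (auto simp: D_def intro: compact_Times)
  moreover have "cmod (Phi_inv f p) \<le> (4 + 4 * R) * M"
    if f: "f \<in> Hol Omega" and M: "\<forall>x\<in>L. cmod (f x) \<le> M" and p: "p \<in> K" for f M p
  proof -
    obtain u v where uv: "p = (u, v)" by (cases p)
    have "cmod u \<le> R" "cmod v \<le> R"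
      using r[OF p] norm_fst_le[of u v] norm_snd_le[of v u] by (auto simp: uv R_def)
    moreover from this have "cmod (u * v) \<le> R * R"
      unfolding norm_mult using R by (intro mult_mono) auto
    ultimately have b: "cmod u \<le> R\<^sup>2" "cmod v \<le> R\<^sup>2" "cmod (u * v) \<le> R\<^sup>2" "cmod v \<le> R"
      using R(2) unfolding power2_eq_square by linarith+
    have hol: "f holomorphic_csphere2_on Omega"
      using f by (simp add: Hol_def)
    let ?g = "f \<circ> Psi_plus_inv" and ?h = "f \<circ> Psi_minus_inv"
    have "cmod (?g (x, y)) \<le> M" "cmod (?h (x, y)) \<le> M" if "cmod x \<le> 2 * R\<^sup>2" "cmod y \<le> 2 * R\<^sup>2" for x y
      using M that by (auto simp: L_def D_def)
    note bd = factor_bounds(1)[OF pullback_plus_in_Hol_C2[OF hol] R2 this(1) b(1,3)]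
      factor_bounds(2)[OF pullback_minus_in_Hol_C2[OF hol] R2 this(2) b(2,3)]
    have "cmod (Phi_inv f p) \<le> cmod (plus_factor ?g (u, u * v)) + cmod v * cmod (minus_factor ?h (v, u * v))"
      by (simp add: Phi_inv_def uv pi_plus_eq pi_minus_eq norm_triangle_le norm_mult)
    also have "\<dots> \<le> 4 * M + R * (4 * M)"
      using b R by (intro add_mono mult_mono bd) auto
    finally show ?thesis
      by (simp add: algebra_simps)
  qed
  moreover have "0 < 4 + 4 * R"
    using R by simp
  ultimately show "\<exists>L c. compactin (subtopology csphere2_top Omega) L \<and> 0 < c \<and>
      (\<forall>f\<in>Hol Omega. \<forall>M. (\<forall>x\<in>L. cmod (f x) \<le> M) \<longrightarrow> (\<forall>y\<in>K. cmod (Phi_inv f y) \<le> c * M))"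
    by blast
qed (auto simp: Phi_inv_right_inverse Hol_Omega_add Hol_Omega_cscale)

section \<open>Past, future and the isomorphism\<close>

lemma monom2_in_Hol_C2: "monom2 p q \<in> Hol_C2"
  unfolding monom2_def case_prod_unfold Hol_C2_iff by (intro allI holomorphic2_at_intros)

lemma Phi_monom2: "Phi (monom2 p q) = f_fun p q"
proof -
  have eq: "f_fun p q = sphere_join G H"
    if "G \<in> Hol_C2" "H \<in> Hol_C2"
      "\<And>z w. z * w \<noteq> 1 \<Longrightarrow> sphere_join G H (Some z, Some w) = z ^ p * w ^ q / (1 - z * w) ^ max p q" for G H
    unfolding f_fun_def
    by (rule extend_fin_eqI[OF chart_open_Omega sphere_join_in_Hol[OF that(1,2)]]) (use that(3) in simp)
  have zero: "(\<lambda>x. 0) \<in> Hol_C2"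
    by simp
  show ?thesis
  proof (cases "q \<le> p")
    case True
    then obtain k where p: "p = q + k"
      using le_Suc_ex by blast
    have "monom2 p q = weight_join (monom2 k q) (\<lambda>x. 0)"
      by (auto simp: p monom2_def weight_join_def fun_eq_iff power_add power_mult_distrib)
    moreover have "f_fun p q = sphere_join (monom2 k q) (\<lambda>x. 0)"
      by (rule eq[OF monom2_in_Hol_C2 zero])
         (simp add: sphere_join_def monom2_def p power_add power_mult_distrib power_divide mult_ac)
    ultimately show ?thesis
      by (simp add: Phi_weight_join monom2_in_Hol_C2)
  next
    case False
    then have "p < q"
      by simp
    then obtain k where q: "q = p + Suc k"
      by (auto simp: less_iff_Suc_add)
    have "monom2 p q = weight_join (\<lambda>x. 0) (monom2 k p)"
      by (auto simp: q monom2_def weight_join_def fun_eq_iff power_add power_mult_distrib)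
    moreover have "f_fun p q = sphere_join (\<lambda>x. 0) (monom2 k p)"
      by (rule eq[OF zero monom2_in_Hol_C2])
         (simp add: sphere_join_def monom2_def q power_add power_mult_distrib power_divide mult_ac)
    ultimately show ?thesis
      by (simp add: Phi_weight_join monom2_in_Hol_C2)
  qed
qed

lemma subspace_Hol_C2: "cfun.subspace Hol_C2"
proof -
  have "0 \<in> Hol_C2"
    using Hol_C2_const_fst_snd(1)[of 0] by (simp add: zero_fun_def)
  then show ?thesis
    by (simp add: cfun.subspace_def Hol_C2_add Hol_C2_cscale)
qed

lemma clinear_on_image_span:
  assumes lin: "clinear_on H T" and H: "cfun.subspace H" and S: "S \<subseteq> H"
  shows "T ` cfun.span S = cfun.span (T ` S)"
proof
  have sp: "cfun.span S \<subseteq> H"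
    using cfun.span_minimal[OF S H] .
  have T0: "T 0 = 0"
  proof -
    have "T (cscale 0 0) = cscale 0 (T 0)"
      using lin cfun.subspace_0[OF H] unfolding clinear_on_def by blast
    then show ?thesis
      by simp
  qed
  have "cfun.subspace {f \<in> H. T f \<in> cfun.span (T ` S)}"
    using lin H T0 by (auto simp: cfun.subspace_def clinear_on_def cfun.span_zero cfun.span_add cfun.span_scale)
  then have "cfun.span S \<subseteq> {f \<in> H. T f \<in> cfun.span (T ` S)}"
    using S by (intro cfun.span_minimal) (auto intro: cfun.span_base)
  then show "T ` cfun.span S \<subseteq> cfun.span (T ` S)"
    by auto
  have "cfun.subspace (T ` cfun.span S)"
    unfolding cfun.subspace_def
  proof (intro conjI ballI allI)
    show "0 \<in> T ` cfun.span S"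
      using T0 cfun.span_zero by (metis imageI)
    fix f g assume "f \<in> T ` cfun.span S" "g \<in> T ` cfun.span S"
    then obtain f' g' where "f = T f'" "g = T g'" "f' \<in> cfun.span S" "g' \<in> cfun.span S"
      by blast
    then show "f + g \<in> T ` cfun.span S"
      using lin sp cfun.span_add[of f' S g'] unfolding clinear_on_def by (metis imageI subsetD)
  next
    fix c f assume "f \<in> T ` cfun.span S"
    then obtain f' where "f = T f'" "f' \<in> cfun.span S"
      by blast
    then show "cscale c f \<in> T ` cfun.span S"
      using lin sp cfun.span_scale[of f' S c] unfolding clinear_on_def by (metis imageI subsetD)
  qed
  then show "cfun.span (T ` S) \<subseteq> T ` cfun.span S"
    by (intro cfun.span_minimal image_mono cfun.span_superset)
qed

lemma homeomorphic_map_Phi: "homeomorphic_map Hol_C2_top Hol_Omega_top Phi"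
proof -
  have "homeomorphic_maps Hol_C2_top Hol_Omega_top Phi Phi_inv"
    by (simp add: homeomorphic_maps_def continuous_map_Phi continuous_map_Phi_inv Phi_inv_Phi Phi_inv_right_inverse)
  then show ?thesis
    using homeomorphic_maps_map by blast
qed

lemma Phi_closure_span_monomials:
  "Phi ` (Hol_C2_top closure_of cfun.span {monom2 p q | p q. P p q}) =
     Hol_Omega_top closure_of cfun.span {f_fun p q | p q. P p q}"
proof -
  let ?S = "{monom2 p q | p q. P p q}"
  have S: "?S \<subseteq> Hol_C2"
    using monom2_in_Hol_C2 by auto
  then have "cfun.span ?S \<subseteq> topspace Hol_C2_top"
    by (simp add: cfun.span_minimal subspace_Hol_C2)
  then have "Phi ` (Hol_C2_top closure_of cfun.span ?S) = Hol_Omega_top closure_of (Phi ` cfun.span ?S)"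
    by (rule homeomorphic_map_closure_of[OF homeomorphic_map_Phi, symmetric])
  also have "Phi ` cfun.span ?S = cfun.span (Phi ` ?S)"
    by (rule clinear_on_image_span[OF clinear_on_Phi subspace_Hol_C2 S])
  also have "Phi ` ?S = {f_fun p q | p q. P p q}"
    by (force simp: Phi_monom2[symmetric])
  finally show ?thesis .
qed

theorem theorem4p7:
  shows "clinear_on Hol_C2 Phi \<and>
         continuous_map Hol_C2_top Hol_Omega_top Phi \<and>
         bij_betw Phi Hol_C2 (Hol Omega) \<and>
         (\<forall>f\<in>Hol Omega. inv_into Hol_C2 Phi f =
            pi_plus (f \<circ> inv_into Omega_plus Psi_plus) +
            pi_minus (f \<circ> inv_into Omega_minus Psi_minus)) \<and>
         continuous_map Hol_Omega_top Hol_C2_top (inv_into Hol_C2 Phi) \<and>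
         Phi ` Hol_C2_minus = Hol_Omega_minus \<and>
         Phi ` Hol_C2_plus = Hol_Omega_plus"
proof (intro conjI)
  show "\<forall>f\<in>Hol Omega. inv_into Hol_C2 Phi f =
            pi_plus (f \<circ> inv_into Omega_plus Psi_plus) +
            pi_minus (f \<circ> inv_into Omega_minus Psi_minus)"
    by (simp add: inv_into_Phi Phi_inv_def inv_into_Psi_plus inv_into_Psi_minus)
  show "continuous_map Hol_Omega_top Hol_C2_top (inv_into Hol_C2 Phi)"
    by (rule continuous_map_eq[OF continuous_map_Phi_inv]) (simp add: inv_into_Phi)
  show "Phi ` Hol_C2_minus = Hol_Omega_minus"
    unfolding Hol_C2_minus_def Hol_Omega_minus_def by (rule Phi_closure_span_monomials)
  show "Phi ` Hol_C2_plus = Hol_Omega_plus"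
    unfolding Hol_C2_plus_def Hol_Omega_plus_def by (rule Phi_closure_span_monomials)
qed (rule clinear_on_Phi continuous_map_Phi bij_betw_Phi)+

end
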